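(* For every integer \(g\ge 1\), let \(\operatorname{pf}_{\max}(g):=\max\{\operatorname{pf}(G): \gamma(G)\le g\}\), the maximum over all finite simple graphs \(G\) of orientable genus at most \(g\). Then \[ \operatorname{pf}_{\max}(g)\ge \left(\tfrac83\right)^g . \] (Equivalently, there exists a finite simple graph \(G\) with \(\gamma(G)\le g\) and \(\operatorname{pf}(G)\ge (8/3)^g\).)
   Context: All graphs are finite and simple. For a graph \(G\) on \(2n\) vertices, assign an independent variable \(x_e\) to each edge \(e\); the perfect-matching polynomial is \(\mathrm{PM}(G)=\sum_{M}\prod_{e\in M}x_e\), summed over all perfect matchings \(M\) of \(G\). Fix an ordering \(1,\dots,2n\) of the vertices. For an orientation \(D\) of \(G\) (a choice of direction of each edge), the weighted skew-adjacency matrix \(A_D\) is the \(2n\times 2n\) matrix with \((A_D)_{ij}=x_{ij}\) if \(ij\) is an edge oriented from \(i\) to \(j\), \(-x_{ij}\) if it is oriented from \(j\) to \(i\), and \(0\) if \(ij\) is not an edge; \(\mathrm{Pf}(A_D)\) denotes its Pfaffian. A graph \(G\) is \(k\)-Pfaffian if there exist orientations \(D_1,\dots,D_k\) of \(G\) and real numbers \(c_1,\dots,c_k\) such that \(\mathrm{PM}(G)=\sum_{i=1}^k c_i\,\mathrm{Pf}(A_{D_i})\) as polynomials. The Pfaffian number \(\operatorname{pf}(G)\) is the least positive integer \(k\) such that \(G\) is \(k\)-Pfaffian. The orientable genus \(\gamma(G)\) is the least \(g\) such that \(G\) embeds without crossings in the orientable surface with \(g\) handles. *)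

theory Defs
  imports
    "HOL-Analysis.Analysis"
    "HOL-Library.Poly_Mapping"
    "HOL-Combinatorics.Permutations"
begin

definition simple_graph :: "'a set \<Rightarrow> 'a set set \<Rightarrow> bool" where
  "simple_graph V E \<longleftrightarrow> finite V \<and> (\<forall>e\<in>E. e \<subseteq> V \<and> card e = 2)"

definition perfect_matchings :: "'a set \<Rightarrow> 'a set set \<Rightarrow> 'a set set set" where
  "perfect_matchings V E = {M. M \<subseteq> E \<and> (\<forall>v\<in>V. \<exists>!e. e \<in> M \<and> v \<in> e)}"

(* Real multivariate polynomials with one variable x_e for each two-element set e of vertices:
   finitely supported maps from monomials (exponent vectors) to coefficients, with the
   convolution product of Poly_Mapping. *)
type_synonym 'a edge_poly = "('a set \<Rightarrow>\<^sub>0 nat) \<Rightarrow>\<^sub>0 real"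

definition edge_var :: "'a set \<Rightarrow> 'a edge_poly" where
  "edge_var e = Poly_Mapping.single (Poly_Mapping.single e 1) 1"

definition const_poly :: "real \<Rightarrow> 'a edge_poly" where
  "const_poly c = Poly_Mapping.single 0 c"

definition PM :: "'a set \<Rightarrow> 'a set set \<Rightarrow> 'a edge_poly" where
  "PM V E = (\<Sum>M\<in>perfect_matchings V E. \<Prod>e\<in>M. edge_var e)"

(* The pair (u, v) stands for the edge {u, v} directed from u to v. *)
definition orientation :: "'a set set \<Rightarrow> ('a \<times> 'a) set \<Rightarrow> bool" where
  "orientation E D \<longleftrightarrow>
     (\<forall>(u, v)\<in>D. {u, v} \<in> E) \<and> (\<forall>u v. {u, v} \<in> E \<longrightarrow> ((u, v) \<in> D \<longleftrightarrow> (v, u) \<notin> D))"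

(* Rows and columns are indexed from 0; the vertices are enumerated in increasing order. *)
definition skew_adjacency ::
  "'a::linorder set \<Rightarrow> ('a \<times> 'a) set \<Rightarrow> nat \<Rightarrow> nat \<Rightarrow> 'a edge_poly" where
  "skew_adjacency V D i j =
     (let u = sorted_list_of_set V ! i; v = sorted_list_of_set V ! j in
        if (u, v) \<in> D then edge_var {u, v}
        else if (v, u) \<in> D then - edge_var {u, v}
        else 0)"

(* The Pfaffian of the 2n x 2n skew-symmetric matrix (A i j), i, j < 2n: the sum over the
   partitions {{i_1, j_1}, ..., {i_n, j_n}} of {0, ..., 2n-1} into pairs, each represented by the
   permutation (i_1, j_1, ..., i_n, j_n) with i_r < j_r for all r and i_1 < ... < i_n. *)
definition pfaffian :: "nat \<Rightarrow> (nat \<Rightarrow> nat \<Rightarrow> 'r::comm_ring_1) \<Rightarrow> 'r" where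
  "pfaffian n A =
     (\<Sum>\<sigma> | \<sigma> permutes {..<2 * n} \<and> (\<forall>r<n. \<sigma> (2 * r) < \<sigma> (2 * r + 1)) \<and>
            (\<forall>r. r + 1 < n \<longrightarrow> \<sigma> (2 * r) < \<sigma> (2 * (r + 1))).
        of_int (sign \<sigma>) * (\<Prod>r<n. A (\<sigma> (2 * r)) (\<sigma> (2 * r + 1))))"

definition k_pfaffian :: "'a::linorder set \<Rightarrow> 'a set set \<Rightarrow> nat \<Rightarrow> bool" where
  "k_pfaffian V E k \<longleftrightarrow>
     (\<exists>(D :: nat \<Rightarrow> ('a \<times> 'a) set) (c :: nat \<Rightarrow> real).
        (\<forall>i<k. orientation E (D i)) \<and>
        PM V E =
          (\<Sum>i<k. const_poly (c i) * pfaffian (card V div 2) (skew_adjacency V (D i))))"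

definition pf :: "'a::linorder set \<Rightarrow> 'a set set \<Rightarrow> nat" where
  "pf V E = (LEAST k. 0 < k \<and> k_pfaffian V E k)"

(* A box with g disjoint square tunnels drilled through it, i.e. a handlebody with g handles.
   Its boundary is the standard model of the orientable surface with g handles. *)
definition handlebody :: "nat \<Rightarrow> (real \<times> real \<times> real) set" where
  "handlebody g =
     {(x, y, z). 0 \<le> x \<and> x \<le> 2 * real g + 1 \<and> 0 \<le> y \<and> y \<le> 3 \<and> 0 \<le> z \<and> z \<le> 1 \<and>
        \<not> (\<exists>i<g. 2 * real i + 1 < x \<and> x < 2 * real i + 2 \<and> 1 < y \<and> y < 2)}"

definition genus_surface :: "nat \<Rightarrow> (real \<times> real \<times> real) set" where
  "genus_surface g = frontier (handlebody g)"

(* A drawing without crossings: vertices are distinct points, edges are simple arcs joining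
   their end vertices, meeting other arcs and vertices only in common end vertices. *)
definition embeds_in :: "'a set \<Rightarrow> 'a set set \<Rightarrow> 'b::topological_space set \<Rightarrow> bool" where
  "embeds_in V E S \<longleftrightarrow>
     (\<exists>(p :: 'a \<Rightarrow> 'b) (\<gamma> :: 'a set \<Rightarrow> real \<Rightarrow> 'b).
        inj_on p V \<and> p ` V \<subseteq> S \<and>
        (\<forall>e\<in>E. arc (\<gamma> e) \<and> path_image (\<gamma> e) \<subseteq> S \<and>
               {pathstart (\<gamma> e), pathfinish (\<gamma> e)} = p ` e \<and>
               path_image (\<gamma> e) \<inter> p ` V = p ` e) \<and>
        (\<forall>e\<in>E. \<forall>f\<in>E. e \<noteq> f \<longrightarrow> path_image (\<gamma> e) \<inter> path_image (\<gamma> f) \<subseteq> p ` (e \<inter> f)))"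

definition orientable_genus :: "'a set \<Rightarrow> 'a set set \<Rightarrow> nat" where
  "orientable_genus V E = (LEAST g. embeds_in V E (genus_surface g))"

(* Every finite graph is isomorphic to one with vertices in nat.  The Pfaffian number is a
   notion for graphs of even order.  The supremum is taken in enat, so that it makes sense
   without first showing that the Pfaffian numbers are bounded. *)
definition pf_max :: "nat \<Rightarrow> enat" where
  "pf_max g =
     (SUP (V, E) \<in> {(V :: nat set, E). simple_graph V E \<and> even (card V) \<and>
                      orientable_genus V E \<le> g}. enat (pf V E))"

end

theory Submission
  imports Defs
begin

text \<open>
  Take g disjoint copies of the complete bipartite graph on 3 + 3 vertices, each drawn around its
  own tunnel.  One copy has six perfect matchings, and the six signs that an orientation gives to
  them have product -1, because every edge lies in exactly two of the matchings and three of the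
  six permutations are odd.  There are 16 sign vectors of product 1 up to a global sign; each has
  nonzero inner product with the all-ones vector, but only 6 of them have nonzero inner product
  with a given sign vector of product -1.  Sign vectors of the whole graph are tensor products over
  the copies.  Pair an expression of PM by k Pfaffians with each of the \<open>16 ^ g\<close> tensor products of
  even vectors: the result is nonzero, hence so is one of the k terms, and each term is nonzero for
  at most \<open>6 ^ g\<close> of them.  Thus \<open>k \<ge> (16 / 6) ^ g\<close>.
\<close>

section \<open>Expansion of Pfaffians into matchings\<close>

definition monomial_of :: "'a set set \<Rightarrow> 'a set \<Rightarrow>\<^sub>0 nat" where
  "monomial_of M = (\<Sum>e\<in>M. Poly_Mapping.single e 1)"

lemma lookup_monomial_of:
  assumes "finite M"
  shows "Poly_Mapping.lookup (monomial_of M) e = (if e \<in> M then 1 else 0)"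
  using assms by (auto simp: monomial_of_def lookup_sum lookup_single when_def)

lemma monomial_of_eq_iff:
  assumes "finite M" "finite N"
  shows "monomial_of M = monomial_of N \<longleftrightarrow> M = N"
proof
  assume "monomial_of M = monomial_of N"
  then have "e \<in> M \<longleftrightarrow> e \<in> N" for e
    using lookup_monomial_of[OF assms(1), of e] lookup_monomial_of[OF assms(2), of e]
    by (metis zero_neq_one)
  then show "M = N" by blast
qed simp

lemma prod_single:
  "(\<Prod>i\<in>I. Poly_Mapping.single (m i :: 'a \<Rightarrow>\<^sub>0 nat) (c i :: real)) =
    Poly_Mapping.single (\<Sum>i\<in>I. m i) (\<Prod>i\<in>I. c i)"
  by (induction I rule: infinite_finite_induct) (auto simp: mult_single)

lemma prod_edge_var: "(\<Prod>e\<in>M. edge_var e) = Poly_Mapping.single (monomial_of M) 1"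
  by (simp add: edge_var_def prod_single monomial_of_def)

lemma finite_perfect_matchings: "finite E \<Longrightarrow> finite (perfect_matchings V E)"
  unfolding perfect_matchings_def by (rule finite_subset[of _ "Pow E"]) auto

lemma perfect_matching_finite: "finite E \<Longrightarrow> M \<in> perfect_matchings V E \<Longrightarrow> finite M"
  unfolding perfect_matchings_def by (auto intro: finite_subset)

text \<open>Distinct finite edge sets have distinct monomials, so at most one summand of
  \<open>PM\<close> contributes to a given coefficient.\<close>

lemma lookup_PM:
  assumes "finite E" "finite M"
  shows "Poly_Mapping.lookup (PM V E) (monomial_of M) = (if M \<in> perfect_matchings V E then 1 else 0)"
proof -
  have "Poly_Mapping.lookup (PM V E) (monomial_of M) =
      (\<Sum>N\<in>perfect_matchings V E. if N = M then 1 else 0)"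
    unfolding PM_def lookup_sum prod_edge_var
  proof (rule sum.cong[OF refl])
    fix N assume "N \<in> perfect_matchings V E"
    then have "finite N" using assms(1) by (rule perfect_matching_finite[rotated])
    then show "Poly_Mapping.lookup (Poly_Mapping.single (monomial_of N) (1::real)) (monomial_of M) =
        (if N = M then 1 else 0)"
      by (simp add: lookup_single when_def monomial_of_eq_iff assms(2))
  qed
  then show ?thesis
    using finite_perfect_matchings[OF assms(1)] by simp
qed

lemma lookup_PM_nonzeroE:
  assumes "Poly_Mapping.lookup (PM V E) k \<noteq> 0"
  obtains M where "M \<in> perfect_matchings V E" "k = monomial_of M"
proof -
  have "(\<Sum>N\<in>perfect_matchings V E. Poly_Mapping.lookup (Poly_Mapping.single (monomial_of N) (1::real)) k) \<noteq> 0"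
    using assms unfolding PM_def lookup_sum prod_edge_var .
  then obtain N where "N \<in> perfect_matchings V E"
    "Poly_Mapping.lookup (Poly_Mapping.single (monomial_of N) (1::real)) k \<noteq> 0"
    by (rule sum.not_neutral_contains_not_neutral)
  then show ?thesis
    using that by (auto simp: lookup_single when_def split: if_splits)
qed

section \<open>Permutations in normal form and the coefficients of a Pfaffian\<close>

definition normal_perms :: "nat \<Rightarrow> (nat \<Rightarrow> nat) set" where
  "normal_perms n = {\<sigma>. \<sigma> permutes {..<2 * n} \<and> (\<forall>r<n. \<sigma> (2 * r) < \<sigma> (2 * r + 1)) \<and>
            (\<forall>r. r + 1 < n \<longrightarrow> \<sigma> (2 * r) < \<sigma> (2 * (r + 1)))}"

definition pairs_of :: "nat \<Rightarrow> (nat \<Rightarrow> nat) \<Rightarrow> nat set set" where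
  "pairs_of n \<sigma> = (\<lambda>r. {\<sigma> (2 * r), \<sigma> (2 * r + 1)}) ` {..<n}"

text \<open>For an edge this is the sign of its entry in the skew-adjacency matrix. The default -1
  on all other pairs lets it square to 1 without a side condition; the Pfaffian formulas evaluate it
  on edges only.\<close>

definition direction_sign :: "(nat \<times> nat) set \<Rightarrow> nat \<Rightarrow> nat \<Rightarrow> int" where
  "direction_sign D u v = (if (u, v) \<in> D then 1 else - 1)"

lemma finite_normal_perms: "finite (normal_perms n)"
  unfolding normal_perms_def
  by (rule finite_subset[OF _ finite_permutations[of "{..<2 * n}"]]) auto

lemma finite_pairs_of: "finite (pairs_of n \<sigma>)"
  by (simp add: pairs_of_def)

lemma normal_perms_inj: "\<sigma> \<in> normal_perms n \<Longrightarrow> \<sigma> x = \<sigma> y \<longleftrightarrow> x = y"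
  unfolding normal_perms_def by (rule inj_eq) (auto intro: permutes_inj)

lemma pairs_of_index_inj:
  assumes "\<sigma> \<in> normal_perms n"
  shows "inj_on (\<lambda>r. {\<sigma> (2 * r), \<sigma> (2 * r + 1)}) {..<n}"
proof (rule inj_onI)
  fix r s
  assume "{\<sigma> (2 * r), \<sigma> (2 * r + 1)} = {\<sigma> (2 * s), \<sigma> (2 * s + 1)}"
  then have "2 * r = 2 * s \<or> 2 * r = 2 * s + 1"
    unfolding doubleton_eq_iff normal_perms_inj[OF assms] by blast
  then show "r = s" by presburger
qed

text \<open>The vertex \<open>\<sigma> x\<close> lies in the pair with index \<open>x div 2\<close>
  and, since \<sigma> is injective, in no other.\<close>

lemma pairs_of_perfect_matching:
  assumes "\<sigma> \<in> normal_perms n" "pairs_of n \<sigma> \<subseteq> E"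
  shows "pairs_of n \<sigma> \<in> perfect_matchings {..<2 * n} E"
proof -
  have \<sigma>: "\<sigma> permutes {..<2 * n}" using assms by (simp add: normal_perms_def)
  have "\<exists>!e. e \<in> pairs_of n \<sigma> \<and> v \<in> e" if v: "v < 2 * n" for v
  proof -
    obtain x where x: "v = \<sigma> x" using surjD[OF permutes_surj[OF \<sigma>]] by blast
    then have "x < 2 * n"
      using v permutes_in_image[OF \<sigma>, of x] by simp
    then have xn: "x div 2 < n" by simp
    show ?thesis
    proof (rule ex1I[of _ "{\<sigma> (2 * (x div 2)), \<sigma> (2 * (x div 2) + 1)}"])
      have "x = 2 * (x div 2) \<or> x = 2 * (x div 2) + 1" by presburger
      then have "v \<in> {\<sigma> (2 * (x div 2)), \<sigma> (2 * (x div 2) + 1)}"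
        unfolding x by (metis insertCI)
      then show "{\<sigma> (2 * (x div 2)), \<sigma> (2 * (x div 2) + 1)} \<in> pairs_of n \<sigma> \<and>
          v \<in> {\<sigma> (2 * (x div 2)), \<sigma> (2 * (x div 2) + 1)}"
        using xn unfolding pairs_of_def by blast
    next
      fix e assume "e \<in> pairs_of n \<sigma> \<and> v \<in> e"
      then obtain r where r: "e = {\<sigma> (2 * r), \<sigma> (2 * r + 1)}" "v \<in> e"
        by (auto simp: pairs_of_def)
      then have "x = 2 * r \<or> x = 2 * r + 1"
        unfolding x using normal_perms_inj[OF assms(1)] by blast
      then have "x div 2 = r" by presburger
      then show "e = {\<sigma> (2 * (x div 2)), \<sigma> (2 * (x div 2) + 1)}" using r by simp
    qed
  qed
  then show ?thesis using assms(2) by (simp add: perfect_matchings_def)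
qed

lemma skew_adjacency_lessThan:
  assumes D: "orientation E D" and "i < N" "j < N"
  shows "skew_adjacency {..<N} D i j =
    (if {i, j} \<in> E then Poly_Mapping.single (Poly_Mapping.single {i, j} 1)
       (of_int (direction_sign D i j)) else 0)"
proof -
  \<comment> \<open>The increasing enumeration of an initial segment is the identity, so matrix
    indices and vertices coincide.\<close>
  have "sorted_list_of_set {..<N} = [0..<N]"
    by (metis sorted_list_of_set_range lessThan_atLeast0)
  then have nth: "sorted_list_of_set {..<N} ! i = i" "sorted_list_of_set {..<N} ! j = j"
    using assms(2,3) by simp_all
  have D1: "(u, v) \<in> D \<Longrightarrow> {u, v} \<in> E" and D2: "{u, v} \<in> E \<Longrightarrow> (u, v) \<in> D \<longleftrightarrow> (v, u) \<notin> D" for u v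
    using D unfolding orientation_def by blast+
  have "(i, j) \<notin> D" "(j, i) \<notin> D" if "{i, j} \<notin> E"
    using that D1[of i j] D1[of j i] by (auto simp: insert_commute)
  then show ?thesis
    using D2[of i j]
    by (simp add: skew_adjacency_def Let_def nth direction_sign_def edge_var_def single_uminus)
qed

text \<open>A pair outside \<open>E\<close> contributes a zero factor; if there is none, the product
  of the entries is a single signed monomial.\<close>

lemma pfaffian_expansion:
  assumes D: "orientation E D"
  shows "pfaffian n (skew_adjacency {..<2 * n} D) =
    (\<Sum>\<sigma>\<in>normal_perms n. if pairs_of n \<sigma> \<subseteq> E
       then Poly_Mapping.single (monomial_of (pairs_of n \<sigma>))
         (of_int (sign \<sigma> * (\<Prod>r<n. direction_sign D (\<sigma> (2 * r)) (\<sigma> (2 * r + 1)))))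
       else 0)"
  unfolding pfaffian_def normal_perms_def[symmetric]
proof (rule sum.cong[OF refl])
  fix \<sigma> assume s: "\<sigma> \<in> normal_perms n"
  have lt: "\<sigma> (2 * r) < 2 * n" "\<sigma> (2 * r + 1) < 2 * n" if "r < n" for r
  proof -
    have "\<sigma> permutes {..<2 * n}" using s by (simp add: normal_perms_def)
    from permutes_in_image[OF this, of "2 * r"] permutes_in_image[OF this, of "2 * r + 1"] that
    show "\<sigma> (2 * r) < 2 * n" "\<sigma> (2 * r + 1) < 2 * n" by auto
  qed
  let ?P = "\<Prod>r<n. skew_adjacency {..<2 * n} D (\<sigma> (2 * r)) (\<sigma> (2 * r + 1))"
  show "of_int (sign \<sigma>) * ?P = (if pairs_of n \<sigma> \<subseteq> E
       then Poly_Mapping.single (monomial_of (pairs_of n \<sigma>))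
         (of_int (sign \<sigma> * (\<Prod>r<n. direction_sign D (\<sigma> (2 * r)) (\<sigma> (2 * r + 1)))))
       else 0)"
  proof (cases "pairs_of n \<sigma> \<subseteq> E")
    case True
    have "?P = (\<Prod>r<n. Poly_Mapping.single (Poly_Mapping.single {\<sigma> (2 * r), \<sigma> (2 * r + 1)} 1)
       (of_int (direction_sign D (\<sigma> (2 * r)) (\<sigma> (2 * r + 1)))))"
      using True lt by (intro prod.cong) (auto simp: skew_adjacency_lessThan[OF D] pairs_of_def)
    also have "\<dots> = Poly_Mapping.single (monomial_of (pairs_of n \<sigma>))
        (of_int (\<Prod>r<n. direction_sign D (\<sigma> (2 * r)) (\<sigma> (2 * r + 1))))"
      unfolding prod_single monomial_of_def pairs_of_def
      by (simp add: sum.reindex[OF pairs_of_index_inj[OF s]] del: One_nat_def)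
    moreover have "of_int (sign \<sigma>) = Poly_Mapping.single (0 :: nat set \<Rightarrow>\<^sub>0 nat) (of_int (sign \<sigma>) :: real)"
      by (rule single_of_int[symmetric])
    ultimately show ?thesis using True by (simp add: mult_single del: single_of_int)
  next
    case False
    then obtain r where r: "r < n" "{\<sigma> (2 * r), \<sigma> (2 * r + 1)} \<notin> E"
      by (auto simp: pairs_of_def)
    have "?P = 0"
      using r lt by (intro prod_zero) (auto simp: skew_adjacency_lessThan[OF D])
    then show ?thesis using False by simp
  qed
qed

lemma lookup_pfaffian_nonzeroE:
  assumes "orientation E D"
    and "Poly_Mapping.lookup (pfaffian n (skew_adjacency {..<2 * n} D)) k \<noteq> 0"
  obtains M where "M \<in> perfect_matchings {..<2 * n} E" "k = monomial_of M"
proof -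
  obtain \<sigma> where s: "\<sigma> \<in> normal_perms n" and nz: "Poly_Mapping.lookup (if pairs_of n \<sigma> \<subseteq> E
       then Poly_Mapping.single (monomial_of (pairs_of n \<sigma>))
         (of_int (sign \<sigma> * (\<Prod>r<n. direction_sign D (\<sigma> (2 * r)) (\<sigma> (2 * r + 1)))) :: real)
       else 0) k \<noteq> 0"
    using assms(2) unfolding pfaffian_expansion[OF assms(1)] lookup_sum
    by (rule sum.not_neutral_contains_not_neutral)
  have "pairs_of n \<sigma> \<subseteq> E" "k = monomial_of (pairs_of n \<sigma>)"
    using nz by (auto simp: lookup_single when_def split: if_splits)
  then show ?thesis using that s pairs_of_perfect_matching by blast
qed

lemma normal_perms_less:
  assumes "\<sigma> \<in> normal_perms n" "r < s" "s < n"
  shows "\<sigma> (2 * r) < \<sigma> (2 * s)"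
  using assms(2,3)
proof (induction s)
  case (Suc s)
  have "\<sigma> (2 * s) < \<sigma> (2 * (s + 1))"
    using assms(1) Suc.prems by (simp add: normal_perms_def)
  then show ?case using Suc by (cases "r = s") auto
qed simp

lemma normal_perms_pair_less: "\<sigma> \<in> normal_perms n \<Longrightarrow> r < n \<Longrightarrow> \<sigma> (2 * r) < \<sigma> (2 * r + 1)"
  by (simp add: normal_perms_def)

lemma pairs_of_minima:
  assumes "\<sigma> \<in> normal_perms n"
  shows "Min ` pairs_of n \<sigma> = (\<lambda>r. \<sigma> (2 * r)) ` {..<n}"
proof -
  have "Min {\<sigma> (2 * r), \<sigma> (2 * r + 1)} = \<sigma> (2 * r)" if "r < n" for r
    using normal_perms_pair_less[OF assms that] by simp
  then show ?thesis unfolding pairs_of_def image_image by (intro image_cong) auto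
qed

text \<open>The minima of the pairs are the values at the even positions, and normal form lists them
  in increasing order. Hence the set of pairs determines the even positions, and each odd position
  holds the other member of its pair.\<close>

lemma normal_perms_eqI:
  assumes s: "\<sigma> \<in> normal_perms n" and t: "\<tau> \<in> normal_perms n" and eq: "pairs_of n \<tau> = pairs_of n \<sigma>"
  shows "\<tau> = \<sigma>"
proof -
  have sorted: "sorted_wrt (<) (map (\<lambda>r. \<rho> (2 * r)) [0..<n])" if "\<rho> \<in> normal_perms n" for \<rho>
    using normal_perms_less[OF that] by (auto simp: sorted_wrt_iff_nth_less)
  have "map (\<lambda>r. \<tau> (2 * r)) [0..<n] = map (\<lambda>r. \<sigma> (2 * r)) [0..<n]"
  proof (rule strict_sorted_equal[OF sorted[OF s] sorted[OF t]])
    show "set (map (\<lambda>r. \<tau> (2 * r)) [0..<n]) = set (map (\<lambda>r. \<sigma> (2 * r)) [0..<n])"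
      using pairs_of_minima[OF s] pairs_of_minima[OF t] eq by (simp add: lessThan_atLeast0)
  qed
  then have evn: "\<tau> (2 * r) = \<sigma> (2 * r)" if "r < n" for r
    using that by simp
  have odd: "\<tau> (2 * r + 1) = \<sigma> (2 * r + 1)" if r: "r < n" for r
  proof -
    have "{\<tau> (2 * r), \<tau> (2 * r + 1)} \<in> pairs_of n \<sigma>"
      using r unfolding eq[symmetric] unfolding pairs_of_def by blast
    then obtain q where q: "q < n" "{\<tau> (2 * r), \<tau> (2 * r + 1)} = {\<sigma> (2 * q), \<sigma> (2 * q + 1)}"
      unfolding pairs_of_def by blast
    have lt: "\<tau> (2 * r) < \<tau> (2 * r + 1)" "\<sigma> (2 * q) < \<sigma> (2 * q + 1)"
      using normal_perms_pair_less r q s t by blast+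
    then have *: "\<tau> (2 * r) = \<sigma> (2 * q)" "\<tau> (2 * r + 1) = \<sigma> (2 * q + 1)"
      using q(2) unfolding doubleton_eq_iff by linarith+
    have "r = q"
      using evn[OF r] * normal_perms_inj[OF s, of "2 * r" "2 * q"] by simp
    then show ?thesis using * by simp
  qed
  show ?thesis
  proof
    fix x
    show "\<tau> x = \<sigma> x"
    proof (cases "x < 2 * n")
      case True
      then have "x div 2 < n" by simp
      then have "\<tau> (2 * (x div 2) + x mod 2) = \<sigma> (2 * (x div 2) + x mod 2)"
        using evn[of "x div 2"] odd[of "x div 2"] mod_less_divisor[of 2 x]
        by (cases "even x") (simp_all add: even_iff_mod_2_eq_zero odd_iff_mod_2_eq_one)
      then show ?thesis by simp
    next
      case False
      have "\<sigma> permutes {..<2 * n}" "\<tau> permutes {..<2 * n}"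
        using s t unfolding normal_perms_def by blast+
      then show ?thesis using False by (simp add: permutes_not_in)
    qed
  qed
qed

text \<open>No two permutations in normal form share a monomial, so nothing cancels and the
  coefficient is one signed product.\<close>

lemma lookup_pfaffian:
  assumes D: "orientation E D" and "\<sigma> \<in> normal_perms n" "pairs_of n \<sigma> \<subseteq> E"
  shows "Poly_Mapping.lookup (pfaffian n (skew_adjacency {..<2 * n} D)) (monomial_of (pairs_of n \<sigma>)) =
    of_int (sign \<sigma> * (\<Prod>r<n. direction_sign D (\<sigma> (2 * r)) (\<sigma> (2 * r + 1))))"
    (is "_ = ?c \<sigma>")
proof -
  have "Poly_Mapping.lookup (pfaffian n (skew_adjacency {..<2 * n} D)) (monomial_of (pairs_of n \<sigma>)) =
    (\<Sum>\<tau>\<in>normal_perms n. if \<tau> = \<sigma> then ?c \<tau> else 0)"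
    unfolding pfaffian_expansion[OF D] lookup_sum
  proof (rule sum.cong[OF refl])
    fix \<tau> assume t: "\<tau> \<in> normal_perms n"
    have "monomial_of (pairs_of n \<tau>) = monomial_of (pairs_of n \<sigma>) \<longleftrightarrow> \<tau> = \<sigma>"
      using normal_perms_eqI[OF assms(2) t] by (auto simp: monomial_of_eq_iff finite_pairs_of)
    then show "Poly_Mapping.lookup (if pairs_of n \<tau> \<subseteq> E
        then Poly_Mapping.single (monomial_of (pairs_of n \<tau>)) (?c \<tau>) else 0)
        (monomial_of (pairs_of n \<sigma>)) = (if \<tau> = \<sigma> then ?c \<tau> else 0)"
      using assms(3) by (auto simp: lookup_single when_def)
  qed
  then show ?thesis using assms(2) finite_normal_perms by simp
qed

section \<open>Matchings and sign vectors of disjoint complete bipartite graphs\<close>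

lemma mod_3_less: "(r::nat) mod 3 < 3"
  by simp

section \<open>Permutations of three symbols acting on the right vertices of the copies\<close>

definition s3 :: "nat \<Rightarrow> nat \<Rightarrow> nat" where
  "s3 m a = [[0,1,2],[1,0,2],[2,1,0],[0,2,1],[1,2,0],[2,0,1]] ! m ! a"

text \<open>The index order common to \<open>s3\<close>, \<open>s3_sign\<close> and
  \<open>block_perm\<close> is: identity, three transpositions, two 3-cycles.\<close>

definition s3_sign :: "nat \<Rightarrow> int" where
  "s3_sign m = [1,-1,-1,-1,1,1] ! m"

lemma lt3_cases: "(a::nat) < 3 \<Longrightarrow> a = 0 \<or> a = 1 \<or> a = 2"
  by auto

lemma lt3E: assumes "(a::nat) < 3" obtains "a = 0" | "a = 1" | "a = 2"
  using assms by linarith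

lemma lt6E: assumes "(a::nat) < 6"
  obtains "a = 0" | "a = 1" | "a = 2" | "a = 3" | "a = 4" | "a = 5"
  using assms by linarith

lemma s3_less: "m < 6 \<Longrightarrow> a < 3 \<Longrightarrow> s3 m a < 3"
  by (elim lt3E lt6E) (simp_all add: s3_def)

lemma s3_complete:
  assumes "x < 3" "y < 3" "z < 3" "x \<noteq> y" "y \<noteq> z" "x \<noteq> z"
  shows "\<exists>m<6. s3 m 0 = x \<and> s3 m 1 = y \<and> s3 m 2 = z"
proof -
  have "(x, y, z) \<in> {(0,1,2),(1,0,2),(2,1,0),(0,2,1),(1,2,0),(2,0,1)}"
    using assms by (elim lt3E) simp_all
  moreover have "(s3 m 0, s3 m 1, s3 m 2) =
      [(0,1,2),(1,0,2),(2,1,0),(0,2,1),(1,2,0),(2,0,1)] ! m" if "m < 6" for m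
    using that by (elim lt6E) (simp_all add: s3_def)
  from this[of 0] this[of 1] this[of 2] this[of 3] this[of 4] this[of 5]
  have "s3 0 0 = 0" "s3 0 1 = 1" "s3 0 2 = 2" "s3 1 0 = 1" "s3 1 1 = 0" "s3 1 2 = 2"
    "s3 2 0 = 2" "s3 2 1 = 1" "s3 2 2 = 0" "s3 3 0 = 0" "s3 3 1 = 2" "s3 3 2 = 1"
    "s3 4 0 = 1" "s3 4 1 = 2" "s3 4 2 = 0" "s3 5 0 = 2" "s3 5 1 = 0" "s3 5 2 = 1"
    by simp_all
  moreover have "(0::nat) < 6" "(1::nat) < 6" "(2::nat) < 6" "(3::nat) < 6" "(4::nat) < 6" "(5::nat) < 6" by simp_all
  ultimately show ?thesis by blast
qed

text \<open>Copy \<open>c\<close> occupies the vertices from \<open>6 * c\<close> to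
  \<open>6 * c + 5\<close>, and \<open>p\<close> is the first of its three right vertices. Products
  of transpositions make the signs immediate.\<close>

definition block_perm :: "nat \<Rightarrow> nat \<Rightarrow> nat \<Rightarrow> nat" where
  "block_perm c m = (let p = 6 * c + 3 in
     [id, Transposition.transpose p (p + 1), Transposition.transpose p (p + 2), Transposition.transpose (p + 1) (p + 2),
      Transposition.transpose p (p + 1) \<circ> Transposition.transpose (p + 1) (p + 2),
      Transposition.transpose (p + 1) (p + 2) \<circ> Transposition.transpose p (p + 1)] ! m)"

lemma block_perm_apply:
  assumes "m < 6"
  shows "a < 3 \<Longrightarrow> block_perm c m (6 * c + 3 + a) = 6 * c + 3 + s3 m a"
    and "x < 6 * c + 3 \<or> 6 * c + 6 \<le> x \<Longrightarrow> block_perm c m x = x"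
proof -
  show "block_perm c m (6 * c + 3 + a) = 6 * c + 3 + s3 m a" if "a < 3"
    using assms that
    by (elim lt3E lt6E) (simp_all add: block_perm_def s3_def Let_def Transposition.transpose_def)
  show "block_perm c m x = x" if "x < 6 * c + 3 \<or> 6 * c + 6 \<le> x"
  proof -
    have "x \<noteq> 6 * c + 3" "x \<noteq> 6 * c + 3 + 1" "x \<noteq> 6 * c + 3 + 2"
      using that by auto
    then show ?thesis
      using assms by (elim lt6E) (simp_all add: block_perm_def Let_def Transposition.transpose_def)
  qed
qed

lemma block_perm_permutes:
  assumes "m < 6"
  shows "block_perm c m permutes {6 * c..<6 * c + 6}"
  using assms
  by (elim lt6E; simp add: block_perm_def Let_def)
    (auto intro!: permutes_id permutes_swap_id permutes_compose)

lemma sign_block_perm: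
  assumes "m < 6"
  shows "sign (block_perm c m) = s3_sign m"
  using assms
  by (elim lt6E; simp add: block_perm_def Let_def s3_sign_def sign_swap_id sign_compose permutation_swap_id)

definition blocks_perm :: "nat \<Rightarrow> (nat \<Rightarrow> nat) \<Rightarrow> nat \<Rightarrow> nat" where
  "blocks_perm n f x = (if x < 6 * n \<and> 3 \<le> x mod 6
     then 6 * (x div 6) + 3 + s3 (f (x div 6)) (x mod 6 - 3) else x)"

text \<open>The two factors move disjoint sets of vertices. Peeling off the last copy in this way
  lets the permutation property and the sign of the closed formula follow by induction.\<close>

lemma blocks_perm_Suc:
  assumes "f n < 6"
  shows "blocks_perm (Suc n) f = blocks_perm n f \<circ> block_perm n (f n)"
proof
  fix x
  consider "x < 6 * n" | "6 * n \<le> x" "x < 6 * n + 3" | a where "a < 3" "x = 6 * n + 3 + a" | "6 * n + 6 \<le> x"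
  proof -
    have "x - (6 * n + 3) < 3 \<and> x = 6 * n + 3 + (x - (6 * n + 3))"
      if "\<not> x < 6 * n + 3" "\<not> 6 * n + 6 \<le> x"
      using that by linarith
    then show thesis using that by (meson not_less)
  qed
  then show "blocks_perm (Suc n) f x = (blocks_perm n f \<circ> block_perm n (f n)) x"
  proof cases
    case 1
    then show ?thesis using block_perm_apply(2)[OF assms, of x] by (simp add: blocks_perm_def)
  next
    case 2
    then obtain k where k: "x = 6 * n + k" "k < 3"
      by (metis add_less_cancel_left le_iff_add)
    then have "x mod 6 = k" by simp
    then show ?thesis using 2 k block_perm_apply(2)[OF assms, of x] by (simp add: blocks_perm_def)
  next
    case (3 a)
    then have "x div 6 = n" "x mod 6 = 3 + a" by (simp_all add: add.assoc)
    then show ?thesis using 3 block_perm_apply(1)[OF assms, of a n] by (simp add: blocks_perm_def)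
  next
    case 4
    then show ?thesis using block_perm_apply(2)[OF assms, of x] by (simp add: blocks_perm_def)
  qed
qed

lemma blocks_perm_0: "blocks_perm 0 f = id"
  by (auto simp: blocks_perm_def)

lemma blocks_perm_permutes:
  "(\<And>c. c < n \<Longrightarrow> f c < 6) \<Longrightarrow> blocks_perm n f permutes {..<6 * n}"
proof (induction n)
  case (Suc n)
  have "block_perm n (f n) permutes {..<6 * Suc n}"
    by (rule permutes_subset[OF block_perm_permutes]) (use Suc.prems in auto)
  moreover have "blocks_perm n f permutes {..<6 * Suc n}"
    by (rule permutes_subset[OF Suc.IH]) (use Suc.prems in auto)
  ultimately show ?case
    unfolding blocks_perm_Suc[of f n, OF Suc.prems[OF lessI]] by (rule permutes_compose)
qed (simp add: blocks_perm_0 permutes_id)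

lemma sign_blocks_perm:
  "(\<And>c. c < n \<Longrightarrow> f c < 6) \<Longrightarrow> sign (blocks_perm n f) = (\<Prod>c<n. s3_sign (f c))"
proof (induction n)
  case (Suc n)
  have "permutation (blocks_perm n f)"
    by (rule permutes_imp_permutation[OF _ blocks_perm_permutes]) (use Suc.prems in auto)
  moreover have "permutation (block_perm n (f n))"
    by (rule permutes_imp_permutation[OF _ block_perm_permutes]) (use Suc.prems in auto)
  ultimately show ?case
    unfolding blocks_perm_Suc[of f n, OF Suc.prems[OF lessI]]
    using Suc by (simp only: sign_compose sign_block_perm lessI less_SucI prod.lessThan_Suc)
qed (simp add: blocks_perm_0)

section \<open>The normal-form permutation for a choice of one matching in each copy\<close>

definition left_vertex :: "nat \<Rightarrow> nat" where
  "left_vertex r = 6 * (r div 3) + r mod 3"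

text \<open>This is the normal form of the matching that joins each left vertex to the vertex three
  places above it. Its sign is a common factor for all matchings and stays unevaluated.\<close>

definition base_perm :: "nat \<Rightarrow> nat \<Rightarrow> nat" where
  "base_perm g x = (if x < 6 * g then left_vertex (x div 2) + (if even x then 0 else 3) else x)"

lemma left_vertex_div_mod:
  "left_vertex r div 6 = r div 3" "left_vertex r mod 6 = r mod 3"
  "(left_vertex r + 3) div 6 = r div 3" "(left_vertex r + 3) mod 6 = r mod 3 + 3"
proof -
  have l: "r mod 3 < 6" "r mod 3 + 3 < 6" using mod_3_less[of r] by linarith+
  then show "left_vertex r div 6 = r div 3" "left_vertex r mod 6 = r mod 3"
    by (simp_all add: left_vertex_def)
  show "(left_vertex r + 3) div 6 = r div 3" "(left_vertex r + 3) mod 6 = r mod 3 + 3"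
    using l by (simp_all add: left_vertex_def add.assoc)
qed

lemma left_vertex_block: "a < 3 \<Longrightarrow> left_vertex (3 * c + a) = 6 * c + a"
  by (simp add: left_vertex_def)

lemma left_vertex_less: "r < s \<Longrightarrow> left_vertex r < left_vertex s"
proof -
  assume rs: "r < s"
  have "r = 3 * (r div 3) + r mod 3" "s = 3 * (s div 3) + s mod 3" by simp_all
  moreover have "r div 3 < s div 3 \<or> r div 3 = s div 3" using rs div_le_mono[of r s 3] by linarith
  ultimately show ?thesis
    using rs mod_3_less[of r] mod_3_less[of s] unfolding left_vertex_def by linarith
qed

lemma base_perm_permutes: "base_perm g permutes {..<6 * g}"
proof (rule bij_imp_permutes)
  have less: "base_perm g x < 6 * g" if "x < 6 * g" for x
  proof -
    have "x div 2 div 3 < g" using that by (simp add: less_mult_imp_div_less mult.commute div_mult2_eq[symmetric])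
    then have "left_vertex (x div 2) + 3 < 6 * g"
      using mod_3_less[of "x div 2"] unfolding left_vertex_def by linarith
    then show ?thesis using that by (simp add: base_perm_def)
  qed
  have "inj_on (base_perm g) {..<6 * g}"
  proof (rule inj_onI)
    fix x y assume xy: "x \<in> {..<6 * g}" "y \<in> {..<6 * g}" "base_perm g x = base_perm g y"
    \<comment> \<open>Quotient and remainder by 6 recover the copy, the place within it and the
      side, hence the argument itself.\<close>
    have *: "base_perm g z div 6 = z div 2 div 3"
      "base_perm g z mod 6 = z div 2 mod 3 + (if even z then 0 else 3)" if "z < 6 * g" for z
      using that left_vertex_div_mod[of "z div 2"] by (simp_all add: base_perm_def)
    have "x div 2 div 3 = y div 2 div 3" using *(1)[of x] *(1)[of y] xy by simp
    moreover have "x div 2 mod 3 + (if even x then 0 else 3) = y div 2 mod 3 + (if even y then 0 else 3)"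
      using *(2)[of x] *(2)[of y] xy by simp
    then have "x div 2 mod 3 = y div 2 mod 3" "even x \<longleftrightarrow> even y"
      using mod_3_less[of "x div 2"] mod_3_less[of "y div 2"] by (auto split: if_splits)
    ultimately have "x div 2 = y div 2" "even x \<longleftrightarrow> even y"
      by (metis mult_div_mod_eq)+
    then show "x = y" by (metis even_two_times_div_two odd_two_times_div_two_succ)
  qed
  moreover have "base_perm g ` {..<6 * g} \<subseteq> {..<6 * g}" using less by auto
  ultimately show "bij_betw (base_perm g) {..<6 * g} {..<6 * g}"
    by (simp add: bij_betw_def endo_inj_surj)
qed (simp add: base_perm_def)

definition matching_perm :: "nat \<Rightarrow> (nat \<Rightarrow> nat) \<Rightarrow> nat \<Rightarrow> nat" where
  "matching_perm g f = blocks_perm g f \<circ> base_perm g"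

lemma matching_perm_apply:
  assumes "r < 3 * g"
  shows "matching_perm g f (2 * r) = left_vertex r"
    and "matching_perm g f (2 * r + 1) = 6 * (r div 3) + 3 + s3 (f (r div 3)) (r mod 3)"
proof -
  have "base_perm g (2 * r) = left_vertex r" "base_perm g (2 * r + 1) = left_vertex r + 3"
    using assms by (simp_all add: base_perm_def)
  moreover have "left_vertex r + 3 < 6 * g"
  proof -
    have "r div 3 < g" using assms by (simp add: less_mult_imp_div_less mult.commute)
    then show ?thesis using mod_3_less[of r] by (simp add: left_vertex_def)
  qed
  ultimately show "matching_perm g f (2 * r) = left_vertex r"
    and "matching_perm g f (2 * r + 1) = 6 * (r div 3) + 3 + s3 (f (r div 3)) (r mod 3)"
    using left_vertex_div_mod[of r] mod_3_less[of r, unfolded not_le[symmetric]]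
    by (simp_all add: matching_perm_def blocks_perm_def del: mod_less_divisor)
qed

text \<open>Normal form survives every choice of \<open>f\<close>: only right vertices are moved,
  they stay in their copy, and there they exceed all left vertices.\<close>

lemma matching_perm_normal:
  assumes "\<And>c. c < g \<Longrightarrow> f c < 6"
  shows "matching_perm g f \<in> normal_perms (3 * g)"
proof -
  have "matching_perm g f permutes {..<6 * g}"
    unfolding matching_perm_def
    by (intro permutes_compose base_perm_permutes blocks_perm_permutes assms)
  moreover have "matching_perm g f (2 * r) < matching_perm g f (2 * r + 1)" if "r < 3 * g" for r
    unfolding matching_perm_apply[OF that] left_vertex_def using mod_3_less[of r] by linarith
  moreover have "matching_perm g f (2 * r) < matching_perm g f (2 * (r + 1))" if "r + 1 < 3 * g" for r
    using that matching_perm_apply(1)[of r g f] matching_perm_apply(1)[of "r + 1" g f] left_vertex_less[of r "r + 1"]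
    by simp
  ultimately show ?thesis by (simp add: normal_perms_def)
qed

lemma sign_matching_perm:
  assumes "\<And>c. c < g \<Longrightarrow> f c < 6"
  shows "sign (matching_perm g f) = sign (base_perm g) * (\<Prod>c<g. s3_sign (f c))"
proof -
  have "permutation (blocks_perm g f)"
    by (rule permutes_imp_permutation[OF _ blocks_perm_permutes]) (use assms in auto)
  moreover have "permutation (base_perm g)"
    by (rule permutes_imp_permutation[OF _ base_perm_permutes]) auto
  ultimately show ?thesis
    by (simp add: matching_perm_def sign_compose sign_blocks_perm assms)
qed

section \<open>The disjoint copies and their perfect matchings\<close>

definition k33s :: "nat \<Rightarrow> nat set set" where
  "k33s g = {{6 * c + l, 6 * c + 3 + r} |c l r. c < g \<and> l < 3 \<and> r < 3}"

lemma vertex_div_mod: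
  fixes l r :: nat
  assumes "l < 3" "r < 3"
  shows "(6 * c + l) div 6 = c" "(6 * c + l) mod 6 = l"
    "(6 * c + 3 + r) div 6 = c" "(6 * c + 3 + r) mod 6 = 3 + r"
  using assms by (simp_all add: add.assoc)

definition s3_matching :: "nat \<Rightarrow> (nat \<Rightarrow> nat) \<Rightarrow> nat set set" where
  "s3_matching g f = {{6 * c + a, 6 * c + 3 + s3 (f c) a} |c a. c < g \<and> a < 3}"

lemma pairs_of_matching_perm: "pairs_of (3 * g) (matching_perm g f) = s3_matching g f"
proof (rule set_eqI)
  fix e
  show "e \<in> pairs_of (3 * g) (matching_perm g f) \<longleftrightarrow> e \<in> s3_matching g f"
  proof
    assume "e \<in> pairs_of (3 * g) (matching_perm g f)"
    then obtain r where r: "r < 3 * g" "e = {matching_perm g f (2 * r), matching_perm g f (2 * r + 1)}"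
      unfolding pairs_of_def by blast
    have "r div 3 < g" using r(1) by (simp add: less_mult_imp_div_less mult.commute)
    then show "e \<in> s3_matching g f"
      unfolding r(2) matching_perm_apply[OF r(1)] left_vertex_def s3_matching_def
      using mod_3_less[of r] by blast
  next
    assume "e \<in> s3_matching g f"
    then obtain c a where ca: "c < g" "a < 3" "e = {6 * c + a, 6 * c + 3 + s3 (f c) a}"
      unfolding s3_matching_def by blast
    have r: "3 * c + a < 3 * g" using ca by linarith
    have "(3 * c + a) div 3 = c" "(3 * c + a) mod 3 = a" using ca by simp_all
    then have "e = {matching_perm g f (2 * (3 * c + a)), matching_perm g f (2 * (3 * c + a) + 1)}"
      using matching_perm_apply[OF r] left_vertex_block[OF ca(2)] ca(3) by simp
    then show "e \<in> pairs_of (3 * g) (matching_perm g f)"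
      using r unfolding pairs_of_def by blast
  qed
qed

lemma s3_matching_subset:
  assumes "\<And>c. c < g \<Longrightarrow> f c < 6"
  shows "s3_matching g f \<subseteq> k33s g"
  unfolding s3_matching_def k33s_def using s3_less assms by blast

lemma s3_matching_perfect:
  assumes "\<And>c. c < g \<Longrightarrow> f c < 6"
  shows "s3_matching g f \<in> perfect_matchings {..<6 * g} (k33s g)"
  using pairs_of_perfect_matching[OF matching_perm_normal[of g f, OF assms], where E = "k33s g"]
    s3_matching_subset[of g f, OF assms] unfolding pairs_of_matching_perm by simp

lemma k33s_left_edge:
  fixes c a :: nat
  assumes "e \<in> k33s g" "6 * c + a \<in> e" "a < 3"
  obtains r where "r < 3" "e = {6 * c + a, 6 * c + 3 + r}"
proof -
  obtain c' l r where e: "e = {6 * c' + l, 6 * c' + 3 + r}" "l < 3" "r < 3"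
    using assms(1) unfolding k33s_def by blast
  then consider "6 * c + a = 6 * c' + l" | "6 * c + a = 6 * c' + (3 + r)" using assms(2) by auto
  then have "c = c' \<and> a = l"
  proof cases
    case 1
    have "(6 * c + a) div 6 = c" "(6 * c' + l) div 6 = c'" using e assms(3) by simp_all
    then show ?thesis using 1 by simp
  next
    case 2
    have "(6 * c + a) mod 6 = a" "(6 * c' + (3 + r)) mod 6 = 3 + r" using e assms(3) by simp_all
    then show ?thesis using 2 assms(3) by simp
  qed
  then show thesis using that e by simp
qed

text \<open>The three left vertices of a copy have distinct partners among its three right vertices,
  so the partners form one of the six permutations in the table.\<close>

lemma perfect_matching_k33sE:
  assumes M: "M \<in> perfect_matchings {..<6 * g} (k33s g)"
  obtains f where "f \<in> {..<g} \<rightarrow>\<^sub>E {..<6}" "M = s3_matching g f"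
proof -
  have sub: "M \<subseteq> k33s g" and ex1: "\<And>v. v < 6 * g \<Longrightarrow> \<exists>!e. e \<in> M \<and> v \<in> e"
    using M by (auto simp: perfect_matchings_def)
  have "\<exists>b. b < 3 \<and> {6 * c + a, 6 * c + 3 + b} \<in> M" if "c < g" "a < 3" for c a
  proof -
    have "6 * c + a < 6 * g" using that by linarith
    then obtain e where e: "e \<in> M" "6 * c + a \<in> e" using ex1 by blast
    then show ?thesis using sub k33s_left_edge[of e g c a, OF _ e(2)] that(2) by blast
  qed
  then obtain b where b: "\<And>c a. c < g \<Longrightarrow> a < 3 \<Longrightarrow> b c a < 3 \<and> {6 * c + a, 6 * c + 3 + b c a} \<in> M"
    by metis
  have b_inj: "b c a \<noteq> b c a'" if c: "c < g" "a < 3" "a' < 3" "a \<noteq> a'" for c a a'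
  proof
    assume eq: "b c a = b c a'"
    have "6 * c + 3 + b c a < 6 * g" using b[OF c(1,2)] c(1) by linarith
    then have "{6 * c + a, 6 * c + 3 + b c a} = {6 * c + a', 6 * c + 3 + b c a}"
      using ex1 b[OF c(1,2)] b[OF c(1,3)] unfolding eq[symmetric] by blast
    then show False using c by (auto simp: doubleton_eq_iff)
  qed
  have "\<exists>m<6. s3 m 0 = b c 0 \<and> s3 m 1 = b c 1 \<and> s3 m 2 = b c 2" if c: "c < g" for c
    by (rule s3_complete) (use b[OF c] b_inj[OF c] in simp_all)
  then obtain m where m: "\<And>c. c < g \<Longrightarrow> m c < 6 \<and> s3 (m c) 0 = b c 0 \<and> s3 (m c) 1 = b c 1 \<and> s3 (m c) 2 = b c 2"
    by metis
  define f where "f = restrict m {..<g}"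
  have f: "f \<in> {..<g} \<rightarrow>\<^sub>E {..<6}" using m by (auto simp: f_def)
  have fb: "s3 (f c) a = b c a" if "c < g" "a < 3" for c a
    using that(2) m[OF that(1)] that(1) by (elim lt3E) (simp_all add: f_def)
  have "M = s3_matching g f"
  proof
    show "s3_matching g f \<subseteq> M"
      unfolding s3_matching_def using fb b by auto
    show "M \<subseteq> s3_matching g f"
    proof
      fix e assume e: "e \<in> M"
      then obtain c l r where elr: "e = {6 * c + l, 6 * c + 3 + r}" "c < g" "l < 3"
        using sub unfolding k33s_def by blast
      have "6 * c + l < 6 * g" using elr by linarith
      then have "e = {6 * c + l, 6 * c + 3 + b c l}"
        using ex1 e b[OF elr(2,3)] elr(1) by blast
      then have "e = {6 * c + l, 6 * c + 3 + s3 (f c) l}"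
        using fb[OF elr(2,3)] by simp
      then show "e \<in> s3_matching g f"
        unfolding s3_matching_def using elr(2,3) by blast
    qed
  qed
  then show thesis using f that by blast
qed

section \<open>Signs of matchings under an orientation, copy by copy\<close>

definition block_sign :: "(nat \<times> nat) set \<Rightarrow> nat \<Rightarrow> nat \<Rightarrow> int" where
  "block_sign D c m = s3_sign m * (\<Prod>a<3. direction_sign D (6 * c + a) (6 * c + 3 + s3 m a))"

lemma prod_lessThan_blocks:
  fixes h :: "nat \<Rightarrow> 'a::comm_monoid_mult"
  shows "(\<Prod>r<3 * g. h r) = (\<Prod>c<g. \<Prod>a<3. h (3 * c + a))"
proof (induction g)
  case (Suc g)
  have "{..<3 * Suc g} = insert (3 * g) (insert (3 * g + 1) (insert (3 * g + 2) {..<3 * g}))" by auto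
  then show ?case using Suc by (simp add: numeral_3_eq_3 ac_simps)
qed simp

text \<open>The sign of the permutation and the product of the directions both split over the
  copies. The sign vector of the whole graph is thus a tensor product, up to the global sign of
  \<open>base_perm\<close>.\<close>

lemma lookup_pfaffian_s3_matching:
  assumes D: "orientation (k33s g) D" and f: "\<And>c. c < g \<Longrightarrow> f c < 6"
  shows "Poly_Mapping.lookup (pfaffian (3 * g) (skew_adjacency {..<6 * g} D)) (monomial_of (s3_matching g f)) =
    of_int (sign (base_perm g) * (\<Prod>c<g. block_sign D c (f c)))"
proof -
  let ?\<sigma> = "matching_perm g f"
  have "(\<Prod>r<3 * g. direction_sign D (?\<sigma> (2 * r)) (?\<sigma> (2 * r + 1))) =
      (\<Prod>c<g. \<Prod>a<3. direction_sign D (6 * c + a) (6 * c + 3 + s3 (f c) a))"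
    unfolding prod_lessThan_blocks
  proof (intro prod.cong refl)
    fix c a assume "c \<in> {..<g}" "a \<in> {..<3::nat}"
    then have "3 * c + a < 3 * g" "a < 3" by auto
    then show "direction_sign D (?\<sigma> (2 * (3 * c + a))) (?\<sigma> (2 * (3 * c + a) + 1)) =
        direction_sign D (6 * c + a) (6 * c + 3 + s3 (f c) a)"
      using matching_perm_apply[of "3 * c + a" g f] left_vertex_block[of a c] by simp
  qed
  then have "sign ?\<sigma> * (\<Prod>r<3 * g. direction_sign D (?\<sigma> (2 * r)) (?\<sigma> (2 * r + 1))) =
      sign (base_perm g) * (\<Prod>c<g. block_sign D c (f c))"
    by (simp add: sign_matching_perm[OF f] block_sign_def prod.distrib)
  moreover have "pairs_of (3 * g) ?\<sigma> \<subseteq> k33s g"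
    unfolding pairs_of_matching_perm by (rule s3_matching_subset[OF f])
  ultimately show ?thesis
    using lookup_pfaffian[OF D matching_perm_normal[of g f, OF f]]
    unfolding pairs_of_matching_perm by simp
qed

lemma direction_sign_square: "direction_sign D u v * direction_sign D u v = 1"
  by (simp add: direction_sign_def)

lemma block_sign_cases: "m < 6 \<Longrightarrow> block_sign D c m \<in> {1, -1}"
  by (elim lt6E) (auto simp: block_sign_def s3_sign_def direction_sign_def numeral_3_eq_3)

lemma prod_block_sign: "(\<Prod>m<6. block_sign D c m) = -1"
proof -
  let ?d = "\<lambda>a b. direction_sign D (6 * c + a) (6 * c + 3 + b)"
  have e: "(\<Prod>a<3. h a) = h 0 * h 1 * h 2" for h :: "nat \<Rightarrow> int"
    by (simp add: numeral_3_eq_3 numeral_2_eq_2)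
  have "{..<6} = {0, 1, 2, 3, 4, 5 :: nat}" by auto
  \<comment> \<open>Each pair of indices occurs in two of the six permutations, which yields the
    squares; the three transpositions yield the minus sign.\<close>
  then have "(\<Prod>m<6. block_sign D c m) = - (\<Prod>a<3. \<Prod>b<3. ?d a b * ?d a b)"
    by (simp add: block_sign_def s3_sign_def s3_def e)
  then show ?thesis by (simp add: direction_sign_square)
qed

section \<open>Pairing with even sign vectors and the bound on the number of Pfaffians\<close>

lemma lookup_const_poly_mult:
  "Poly_Mapping.lookup (const_poly c * p) k = c * Poly_Mapping.lookup p k"
proof -
  have "const_poly c * p = Poly_Mapping.map ((*) c) p"
    unfolding const_poly_def by (rule mult_map_scale_conv_mult[symmetric])
  then show ?thesis by (simp add: map.rep_eq when_def)
qed

lemma finite_k33s: "finite (k33s g)"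
proof (rule finite_subset)
  show "k33s g \<subseteq> Pow {..<6 * g}" by (auto simp: k33s_def)
qed simp

lemma finite_s3_matching: "finite (s3_matching g f)"
  unfolding pairs_of_matching_perm[symmetric] by (rule finite_pairs_of)

text \<open>The sign vectors of length 6 with product 1, one from each pair of opposite vectors.  A sign
  vector with product -1 differs from an even one in an odd number of places, so their inner
  product vanishes unless that number is 1 or 5.\<close>

definition even_vectors :: "int list list" where
  "even_vectors = filter (\<lambda>\<alpha>. prod_list \<alpha> = 1 \<and> hd \<alpha> = 1) (List.n_lists 6 [1, -1])"

text \<open>Of the 64 sign vectors 32 have product 1, and fixing the head leaves 16. An even number
  of entries -1 and a head 1 make the sum 6, 2 or -2.\<close>

lemma even_vectors_code:
  "distinct even_vectors \<and> length even_vectors = 16 \<and> (\<forall>\<alpha>\<in>set even_vectors. length \<alpha> = 6 \<and> sum_list \<alpha> \<noteq> 0)"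
  by code_simp

text \<open>Flipping one of the six places of \<open>v\<close> gives, up to a global sign, one
  vector of the list. All others differ from \<open>v\<close> in three places and are orthogonal to
  it.\<close>

lemma even_vectors_orthogonal_code:
  "\<forall>v\<in>set (List.n_lists 6 [1, -1 :: int]). prod_list v = -1 \<longrightarrow>
     length (filter (\<lambda>\<alpha>. sum_list (map2 (*) \<alpha> v) \<noteq> 0) even_vectors) \<le> 6"
  by code_simp

lemma card_even_vectors: "card (set even_vectors) = 16"
  using even_vectors_code by (simp add: distinct_card)

lemma sum_lessThan_6: "(\<Sum>m<6::nat. h m) = h 0 + h 1 + h 2 + h 3 + h 4 + (h 5 :: int)"
  by (simp add: eval_nat_numeral)

lemma prod_lessThan_6: "(\<Prod>m<6::nat. h m) = h 0 * h 1 * h 2 * h 3 * h 4 * (h 5 :: int)"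
  by (simp add: eval_nat_numeral)

lemma length_6E:
  assumes "length xs = 6"
  obtains a b c d e f where "xs = [a, b, c, d, e, f]"
  using assms by (auto simp: eval_nat_numeral length_Suc_conv)

lemma even_vector_sum:
  assumes "\<alpha> \<in> set even_vectors"
  shows "(\<Sum>m<6. \<alpha> ! m) \<noteq> 0"
proof -
  have "length \<alpha> = 6" "sum_list \<alpha> \<noteq> 0" using assms even_vectors_code by auto
  then show ?thesis
    by (elim length_6E) (simp add: sum_lessThan_6 add.assoc)
qed

lemma card_even_vectors_not_orthogonal:
  assumes "\<And>m. m < 6 \<Longrightarrow> v m \<in> {1, -1 :: int}" and "(\<Prod>m<6. v m) = -1"
  shows "card {\<alpha> \<in> set even_vectors. (\<Sum>m<6. \<alpha> ! m * v m) \<noteq> 0} \<le> 6"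
proof -
  let ?v = "[v 0, v 1, v 2, v 3, v 4, v 5]"
  let ?L = "filter (\<lambda>\<alpha>. sum_list (map2 (*) \<alpha> ?v) \<noteq> 0) even_vectors"
  have "length ?v = 6" "set ?v \<subseteq> {1, -1}"
    using assms(1)[of 0] assms(1)[of 1] assms(1)[of 2] assms(1)[of 3] assms(1)[of 4] assms(1)[of 5]
    by simp_all
  then have "?v \<in> set (List.n_lists 6 [1, -1])" unfolding set_n_lists by simp
  moreover have "prod_list ?v = -1" using assms(2) unfolding prod_lessThan_6 by (simp add: mult.assoc)
  ultimately have le: "length ?L \<le> 6" using even_vectors_orthogonal_code by blast
  have "{\<alpha> \<in> set even_vectors. (\<Sum>m<6. \<alpha> ! m * v m) \<noteq> 0} = set ?L"
  proof -
    have "(\<Sum>m<6. \<alpha> ! m * v m) = sum_list (map2 (*) \<alpha> ?v)" if "\<alpha> \<in> set even_vectors" for \<alpha>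
    proof -
      have "length \<alpha> = 6" using that even_vectors_code by auto
      then show ?thesis by (elim length_6E) (simp add: sum_lessThan_6 add.assoc)
    qed
    then show ?thesis by auto
  qed
  then show ?thesis using le card_length[of ?L] by simp
qed

lemma k_pfaffian_k33s_bound:
  assumes "k_pfaffian {..<6 * g} (k33s g) k"
  shows "16 ^ g \<le> k * 6 ^ g"
proof -
  obtain D c where D: "\<And>i. i < k \<Longrightarrow> orientation (k33s g) (D i)"
    and PM: "PM {..<6 * g} (k33s g) =
      (\<Sum>i<k. const_poly (c i) * pfaffian (3 * g) (skew_adjacency {..<6 * g} (D i)))"
    using assms unfolding k_pfaffian_def by auto
  define F where "F = {..<g} \<rightarrow>\<^sub>E {..<6::nat}"
  define A where "A = {..<g} \<rightarrow>\<^sub>E set even_vectors"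
  \<comment> \<open>\<open>L \<alpha>\<close> is the linear functional that pairs the coefficients
    at the perfect matchings with the tensor product of the vectors
    \<open>\<alpha> b\<close>.\<close>
  define L where "L \<alpha> p = (\<Sum>f\<in>F. of_int (\<Prod>b<g. \<alpha> b ! f b) * Poly_Mapping.lookup p (monomial_of (s3_matching g f)))"
    for \<alpha> :: "nat \<Rightarrow> int list" and p :: "nat edge_poly"
  have Fless: "f b < 6" if "f \<in> F" "b < g" for f b
    using that by (auto simp: F_def)
  have L_PM: "L \<alpha> (PM {..<6 * g} (k33s g)) \<noteq> 0" if "\<alpha> \<in> A" for \<alpha>
  proof -
    \<comment> \<open>All these coefficients are 1, so the sum over choice functions factors into
      the entry sums of the vectors \<open>\<alpha> b\<close>.\<close>
    have "L \<alpha> (PM {..<6 * g} (k33s g)) = (\<Sum>f\<in>F. of_int (\<Prod>b<g. \<alpha> b ! f b))"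
      unfolding L_def
      by (intro sum.cong) (use s3_matching_perfect Fless in
        \<open>auto simp: lookup_PM[OF finite_k33s finite_s3_matching]\<close>)
    also have "\<dots> = of_int (\<Prod>b<g. \<Sum>m<6. \<alpha> b ! m)"
      unfolding F_def by (subst prod_sum_PiE) simp_all
    also have "\<dots> \<noteq> 0"
    proof -
      have "\<alpha> b \<in> set even_vectors" if "b < g" for b using \<open>\<alpha> \<in> A\<close> that by (auto simp: A_def)
      then have "(\<Prod>b<g. \<Sum>m<6. \<alpha> b ! m) \<noteq> 0" using even_vector_sum by (simp add: prod_zero_iff)
      then show ?thesis by (simp only: of_int_eq_0_iff not_False_eq_True)
    qed
    finally show ?thesis .
  qed
  \<comment> \<open>The same factorisation, now with the inner products of \<open>\<alpha> b\<close>
    and the sign vector of copy \<open>b\<close>.\<close>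
  have L_pf: "L \<alpha> (pfaffian (3 * g) (skew_adjacency {..<6 * g} (D i))) =
      of_int (sign (base_perm g) * (\<Prod>b<g. \<Sum>m<6. \<alpha> b ! m * block_sign (D i) b m))" if "i < k" for \<alpha> i
  proof -
    have "L \<alpha> (pfaffian (3 * g) (skew_adjacency {..<6 * g} (D i))) =
        (\<Sum>f\<in>F. of_int (sign (base_perm g) * (\<Prod>b<g. \<alpha> b ! f b * block_sign (D i) b (f b))))"
      unfolding L_def
    proof (rule sum.cong[OF refl])
      fix f assume f: "f \<in> F"
      show "of_int (\<Prod>b<g. \<alpha> b ! f b) * Poly_Mapping.lookup
          (pfaffian (3 * g) (skew_adjacency {..<6 * g} (D i))) (monomial_of (s3_matching g f)) =
        real_of_int (sign (base_perm g) * (\<Prod>b<g. \<alpha> b ! f b * block_sign (D i) b (f b)))"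
        using lookup_pfaffian_s3_matching[of g "D i" f, OF D[OF that] Fless[OF f]]
        by (simp add: prod.distrib)
    qed
    also have "\<dots> = of_int (sign (base_perm g) * (\<Sum>f\<in>F. \<Prod>b<g. \<alpha> b ! f b * block_sign (D i) b (f b)))"
      by (simp only: sum_distrib_left of_int_sum)
    also have "(\<Sum>f\<in>F. \<Prod>b<g. \<alpha> b ! f b * block_sign (D i) b (f b)) =
        (\<Prod>b<g. \<Sum>m<6. \<alpha> b ! m * block_sign (D i) b m)"
      unfolding F_def by (rule prod_sum_PiE[symmetric]) simp_all
    finally show ?thesis .
  qed
  have L_lin: "L \<alpha> (\<Sum>i<k. const_poly (c i) * p i) = (\<Sum>i<k. c i * L \<alpha> (p i))" for \<alpha> p
    unfolding L_def lookup_sum lookup_const_poly_mult sum_distrib_left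
    by (subst sum.swap) (simp add: ac_simps)
  define N where "N i b = {\<alpha> \<in> set even_vectors. (\<Sum>m<6. \<alpha> ! m * block_sign (D i) b m) \<noteq> 0}" for i b
  \<comment> \<open>A product is nonzero only if every factor is, so the tensors that detect one
    Pfaffian lie in a box. The \<open>k\<close> boxes cover \<open>A\<close>, since each tensor in
    \<open>A\<close> detects \<open>PM\<close>.\<close>
  have "A \<subseteq> (\<Union>i<k. PiE {..<g} (N i))"
  proof
    fix \<alpha> assume \<alpha>: "\<alpha> \<in> A"
    have "(\<Sum>i<k. c i * L \<alpha> (pfaffian (3 * g) (skew_adjacency {..<6 * g} (D i)))) \<noteq> 0"
      using L_PM[OF \<alpha>] unfolding PM L_lin .
    then obtain i where i: "i \<in> {..<k}" "c i * L \<alpha> (pfaffian (3 * g) (skew_adjacency {..<6 * g} (D i))) \<noteq> 0"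
      by (rule sum.not_neutral_contains_not_neutral)
    then have "of_int (sign (base_perm g) * (\<Prod>b<g. \<Sum>m<6. \<alpha> b ! m * block_sign (D i) b m)) \<noteq> (0::real)"
      using L_pf[of i \<alpha>] by (metis lessThan_iff mult_zero_right)
    then have "(\<Prod>b<g. \<Sum>m<6. \<alpha> b ! m * block_sign (D i) b m) \<noteq> 0"
      by (metis mult_zero_right of_int_0)
    then have "\<And>b. b < g \<Longrightarrow> (\<Sum>m<6. \<alpha> b ! m * block_sign (D i) b m) \<noteq> 0"
      by (simp add: prod_zero_iff)
    then have "\<alpha> \<in> PiE {..<g} (N i)"
      using \<alpha> by (auto simp: A_def N_def PiE_iff)
    then show "\<alpha> \<in> (\<Union>i<k. PiE {..<g} (N i))" using i by blast
  qed
  moreover have "finite (PiE {..<g} (N i))" for i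
    by (rule finite_PiE) (auto simp: N_def)
  ultimately have "card A \<le> card (\<Union>i<k. PiE {..<g} (N i))"
    by (intro card_mono) auto
  also have "\<dots> \<le> (\<Sum>i<k. card (PiE {..<g} (N i)))"
    by (rule card_UN_le) simp
  also have "\<dots> \<le> (\<Sum>i<k. 6 ^ g)"
  proof (rule sum_mono)
    fix i assume "i \<in> {..<k}"
    have "card (N i b) \<le> 6" for b
      unfolding N_def by (rule card_even_vectors_not_orthogonal) (auto simp: block_sign_cases[simplified] prod_block_sign)
    then have "(\<Prod>b<g. card (N i b)) \<le> (\<Prod>b<g. 6)"
      by (intro prod_mono) auto
    then show "card (PiE {..<g} (N i)) \<le> 6 ^ g" by (simp add: card_PiE)
  qed
  finally show ?thesis by (simp add: A_def card_PiE card_even_vectors)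
qed

section \<open>Existence of an expression by Pfaffians\<close>

text \<open>Orientations of one copy of the complete bipartite graph whose sign vectors are -1 exactly on
  \<open>{0}\<close>, \<open>{1}\<close>, \<open>{2}\<close> and \<open>{3, 4, 5}\<close>, so that they add up to the constant vector 2.\<close>

definition witness_sign :: "nat \<Rightarrow> nat \<Rightarrow> nat \<Rightarrow> int" where
  "witness_sign j l r = [
     [[1, 1, 1], [1, 1, -1], [-1, 1, -1]],
     [[1, 1, 1], [1, 1, -1], [-1, 1, 1]],
     [[1, 1, 1], [1, -1, -1], [-1, 1, -1]],
     [[1, 1, 1], [1, -1, -1], [1, -1, -1]]] ! j ! l ! r"

lemma lt4E: assumes "(a::nat) < 4" obtains "a = 0" | "a = 1" | "a = 2" | "a = 3"
  using assms by linarith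

lemma witness_sign_cases:
  assumes "j < 4" "l < 3" "r < 3"
  shows "witness_sign j l r = 1 \<or> witness_sign j l r = -1"
  using assms by (elim lt3E lt4E) (simp_all add: witness_sign_def)

lemma sum_witness_sign:
  assumes "m < 6"
  shows "(\<Sum>j<4. s3_sign m * (\<Prod>a<3. witness_sign j a (s3 m a))) = 2"
  using assms by (elim lt6E) (simp_all add: eval_nat_numeral s3_sign_def s3_def witness_sign_def)

text \<open>The sign refers to the direction from left to right, and \<open>h\<close> picks a
  witness for each copy. The branch for pairs starting on the right negates the other branch, so
  every \<open>h\<close> yields an orientation.\<close>

definition witness_orientation :: "nat \<Rightarrow> (nat \<Rightarrow> nat) \<Rightarrow> (nat \<times> nat) set" where
  "witness_orientation g h = {(u, v). {u, v} \<in> k33s g \<and>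
     (if u mod 6 < 3 then witness_sign (h (u div 6)) (u mod 6) (v mod 6 - 3) = 1
      else witness_sign (h (v div 6)) (v mod 6) (u mod 6 - 3) \<noteq> 1)}"

lemma direction_sign_witness:
  assumes "c < g" "l < 3" "r < 3" "h c < 4"
  shows "direction_sign (witness_orientation g h) (6 * c + l) (6 * c + 3 + r) = witness_sign (h c) l r"
proof -
  have "{6 * c + l, 6 * c + 3 + r} \<in> k33s g" using assms unfolding k33s_def by blast
  then show ?thesis
    using assms(2) witness_sign_cases[OF assms(4,2,3)]
    by (auto simp: direction_sign_def witness_orientation_def vertex_div_mod[OF assms(2,3)])
qed

lemma orientation_witness: "orientation (k33s g) (witness_orientation g h)"
proof -
  have "(u, v) \<in> witness_orientation g h \<longleftrightarrow> (v, u) \<notin> witness_orientation g h" if e: "{u, v} \<in> k33s g" for u v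
  proof -
    obtain c l r where clr: "{u, v} = {6 * c + l, 6 * c + 3 + r}" "l < 3" "r < 3"
      using e unfolding k33s_def by blast
    have e': "{v, u} \<in> k33s g" using e by (simp add: insert_commute)
    from clr(1) consider "u = 6 * c + l" "v = 6 * c + 3 + r" | "v = 6 * c + l" "u = 6 * c + 3 + r"
      unfolding doubleton_eq_iff by blast
    then show ?thesis
      by cases (use e e' clr(2) in \<open>simp_all add: witness_orientation_def vertex_div_mod[OF clr(2,3)]\<close>)
  qed
  then show ?thesis by (auto simp: orientation_def witness_orientation_def)
qed

text \<open>\<open>pf\<close> is a \<open>LEAST\<close>, which has its defining property only once
  some \<open>k\<close> is known to have it. Here \<open>k\<close> is \<open>4 ^ g\<close>: one
  orientation for each choice of a witness in every copy.\<close>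

lemma k_pfaffian_k33s_exists: "\<exists>k>0. k_pfaffian {..<6 * g} (k33s g) k"
proof -
  define H where "H = {..<g} \<rightarrow>\<^sub>E {..<4::nat}"
  have finH: "finite H" unfolding H_def by (intro finite_PiE) auto
  obtain h where h: "bij_betw h {0..<card H} H" using ex_bij_betw_nat_finite[OF finH] by blast
  define D where "D i = witness_orientation g (h i)" for i
  \<comment> \<open>The witness vectors of a copy add up to 2 in every entry, so all choices
    together give \<open>2 ^ g\<close> times the sign of \<open>base_perm\<close>; the coefficient
    cancels both factors.\<close>
  define c where "c i = real_of_int (sign (base_perm g)) / 2 ^ g" for i :: nat
  let ?S = "\<Sum>i<card H. const_poly (c i) * pfaffian (3 * g) (skew_adjacency {..<6 * g} (D i))"
  have D: "orientation (k33s g) (D i)" for i unfolding D_def by (rule orientation_witness)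
  have "PM {..<6 * g} (k33s g) = ?S"
  proof (rule poly_mapping_eqI)
    fix k
    have S: "Poly_Mapping.lookup ?S k = (\<Sum>i<card H. c i *
        Poly_Mapping.lookup (pfaffian (3 * g) (skew_adjacency {..<6 * g} (D i))) k)"
      by (simp add: lookup_sum lookup_const_poly_mult)
    show "Poly_Mapping.lookup (PM {..<6 * g} (k33s g)) k = Poly_Mapping.lookup ?S k"
    proof (cases "\<exists>M\<in>perfect_matchings {..<6 * g} (k33s g). k = monomial_of M")
      case False
      have "Poly_Mapping.lookup (pfaffian (3 * g) (skew_adjacency {..<6 * g} (D i))) k = 0" for i
        using lookup_pfaffian_nonzeroE[OF D[of i], of "3 * g" k] False by auto
      moreover have "Poly_Mapping.lookup (PM {..<6 * g} (k33s g)) k = 0"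
        using lookup_PM_nonzeroE False by metis
      ultimately show ?thesis unfolding S by simp
    next
      case True
      then obtain M where M: "M \<in> perfect_matchings {..<6 * g} (k33s g)" "k = monomial_of M" by blast
      obtain f where f: "f \<in> {..<g} \<rightarrow>\<^sub>E {..<6}" "M = s3_matching g f"
        using perfect_matching_k33sE[OF M(1)] by blast
      have f6: "f b < 6" if "b < g" for b using f(1) that by auto
      have bs: "block_sign (witness_orientation g x) b (f b) =
          s3_sign (f b) * (\<Prod>a<3. witness_sign (x b) a (s3 (f b) a))" if "x \<in> H" "b < g" for x b
      proof -
        have "x b < 4" using that by (auto simp: H_def)
        then show ?thesis
          unfolding block_sign_def using that s3_less[OF f6[OF that(2)]]
          by (intro arg_cong2[where f = "(*)"] prod.cong refl direction_sign_witness) auto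
      qed
      have "Poly_Mapping.lookup ?S k = (\<Sum>i<card H. c i *
          of_int (sign (base_perm g) * (\<Prod>b<g. block_sign (D i) b (f b))))"
        unfolding S unfolding M(2) f(2)
        using lookup_pfaffian_s3_matching[of g _ f, OF D f6] by simp
      also have "\<dots> = (\<Sum>i<card H. of_int (\<Prod>b<g. block_sign (D i) b (f b)) / 2 ^ g)"
      proof (rule sum.cong[OF refl])
        fix i
        have "real_of_int (sign (base_perm g)) * real_of_int (sign (base_perm g)) = 1"
          by (metis of_int_1 of_int_mult sign_idempotent)
        then show "c i * of_int (sign (base_perm g) * (\<Prod>b<g. block_sign (D i) b (f b))) =
            of_int (\<Prod>b<g. block_sign (D i) b (f b)) / 2 ^ g"
          by (simp add: c_def field_simps)
      qed
      also have "\<dots> = (\<Sum>x\<in>H. of_int (\<Prod>b<g. block_sign (witness_orientation g x) b (f b)) / 2 ^ g)"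
        unfolding D_def lessThan_atLeast0
        by (rule sum.reindex_bij_betw[OF h, where g = "\<lambda>x. of_int (\<Prod>b\<in>{0..<g}. block_sign (witness_orientation g x) b (f b)) / 2 ^ g"])
      also have "\<dots> = of_int (\<Sum>x\<in>H. \<Prod>b<g. s3_sign (f b) * (\<Prod>a<3. witness_sign (x b) a (s3 (f b) a))) / 2 ^ g"
        using bs by (simp add: sum_divide_distrib)
      also have "(\<Sum>x\<in>H. \<Prod>b<g. s3_sign (f b) * (\<Prod>a<3. witness_sign (x b) a (s3 (f b) a))) =
          (\<Prod>b<g. \<Sum>j<4. s3_sign (f b) * (\<Prod>a<3. witness_sign j a (s3 (f b) a)))"
        unfolding H_def by (rule prod_sum_PiE[symmetric]) simp_all
      also have "\<dots> = 2 ^ g"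
        using sum_witness_sign f6 by simp
      finally have "Poly_Mapping.lookup ?S k = 1" by simp
      then show ?thesis
        using M f(2) lookup_PM[OF finite_k33s finite_s3_matching, of "{..<6 * g}"] by simp
    qed
  qed
  then have "k_pfaffian {..<6 * g} (k33s g) (card H)"
    unfolding k_pfaffian_def using D by auto
  moreover have "card H > 0" by (simp add: H_def card_PiE)
  ultimately show ?thesis by blast
qed

section \<open>A crossing-free drawing\<close>

text \<open>Copy c is drawn around tunnel c.  One left vertex and the three right vertices lie on the line
  \<open>x = 2 c + 1\<close>, which contains a side of the tunnel; the other two left vertices lie on either
  side of this line and are joined to the right vertices by straight segments on the top face,
  the right-hand one being placed such that its segments avoid the tunnel.  The edge joining the
  first left and the first right vertex runs down the tunnel wall, along the bottom face and up
  the front face.\<close>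

definition left_point :: "nat \<Rightarrow> nat \<Rightarrow> real \<times> real \<times> real" where
  "left_point c l = (if l = 0 then (2 * real c + 1, 1, 1)
     else if l = 1 then (2 * real c + 9/10, 1, 1) else (2 * real c + 14/5, 13/10, 1))"

definition right_point :: "nat \<Rightarrow> nat \<Rightarrow> real \<times> real \<times> real" where
  "right_point c r = (2 * real c + 1, if r = 0 then 0 else if r = 1 then 1/2 else 3, 1)"

definition vertex_point :: "nat \<Rightarrow> real \<times> real \<times> real" where
  "vertex_point v = (if v mod 6 < 3 then left_point (v div 6) (v mod 6)
     else right_point (v div 6) (v mod 6 - 3))"

definition edge_path :: "nat \<Rightarrow> nat \<Rightarrow> nat \<Rightarrow> real \<Rightarrow> real \<times> real \<times> real" where
  "edge_path c l r = (let x = 2 * real c + 1 in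
     if l = 0 \<and> r = 0 then
       linepath (x, 1, 1) (x, 1, 0) +++ linepath (x, 1, 0) (x, 0, 0) +++ linepath (x, 0, 0) (x, 0, 1)
     else linepath (left_point c l) (right_point c r))"

lemma vertex_point_simps:
  "l < 3 \<Longrightarrow> vertex_point (6 * c + l) = left_point c l"
  "r < 3 \<Longrightarrow> vertex_point (6 * c + 3 + r) = right_point c r"
  using vertex_div_mod[of l 0] vertex_div_mod[of 0 r] by (simp_all add: vertex_point_def)

lemma lessThan_k33sE:
  assumes "v < 6 * (g::nat)"
  obtains c l where "c < g" "l < 3" "v = 6 * c + l"
  | c r where "c < g" "r < 3" "v = 6 * c + 3 + r"
proof -
  have g: "v div 6 < g" using assms by (simp add: less_mult_imp_div_less mult.commute)
  have v: "6 * (v div 6) + v mod 6 = v" by simp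
  show thesis
  proof (cases "v mod 6 < 3")
    case True
    then show thesis using g v that(1)[of "v div 6" "v mod 6"] by simp
  next
    case False
    have "v mod 6 - 3 < 3" by (simp add: less_diff_conv2 False less_imp_le not_less)
    moreover have "v = 6 * (v div 6) + 3 + (v mod 6 - 3)" using v False by linarith
    ultimately show thesis using g that(2) by blast
  qed
qed

lemma vertex_point_x:
  assumes "vertex_point v = (x, y, z)"
  shows "2 * real (v div 6) + 9/10 \<le> x" "x \<le> 2 * real (v div 6) + 14/5"
  using assms by (auto simp: vertex_point_def left_point_def right_point_def split: if_splits)

lemma vertex_point_inj: "inj vertex_point"
proof (rule injI)
  fix v w assume eq: "vertex_point v = vertex_point w"
  obtain x y z where p: "vertex_point v = (x, y, z)" by (metis prod.exhaust)
  have "real (v div 6) < real (w div 6) + 1" "real (w div 6) < real (v div 6) + 1"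
    using vertex_point_x[OF p] vertex_point_x[OF p[unfolded eq]] by linarith+
  then have d: "v div 6 = w div 6" by linarith
  have "v mod 6 \<in> {0,1,2,3,4,5}" "w mod 6 \<in> {0,1,2,3,4,5}" by auto
  then have "v mod 6 = w mod 6"
    using eq d by (auto simp: vertex_point_def left_point_def right_point_def split: if_splits)
  then show "v = w" using d by (metis mult_div_mod_eq)
qed

text \<open>These are the possible positions on an arc: the detour through the tunnel, the two
  segments on the central line, and the segments from the two outer left vertices, where
  \<open>t\<close> runs from the left end to the right end. Later claims about positions are case
  checks on this list.\<close>

lemma path_image_edge_path_cases:
  assumes "(x, y, z) \<in> path_image (edge_path c l r)" "l < 3" "r < 3"
  obtains "l = 0" "r = 0" "x = 2 * real c + 1" "0 \<le> y" "y \<le> 1" "0 \<le> z" "z \<le> 1"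
      "y = 1 \<or> z = 0 \<or> y = 0"
  | "l = 0" "r = 1" "x = 2 * real c + 1" "1/2 \<le> y" "y \<le> 1" "z = 1"
  | "l = 0" "r = 2" "x = 2 * real c + 1" "1 \<le> y" "y \<le> 3" "z = 1"
  | t where "l = 1" "0 \<le> t" "t \<le> 1" "x = 2 * real c + 1 - (1 - t) / 10"
      "y = 1 - t + t * (if r = 0 then 0 else if r = 1 then 1/2 else 3)" "z = 1"
  | t where "l = 2" "0 \<le> t" "t \<le> 1" "x = 2 * real c + 1 + (1 - t) * (9/5)"
      "y = (1 - t) * (13/10) + t * (if r = 0 then 0 else if r = 1 then 1/2 else 3)" "z = 1"
proof (cases "l = 0 \<and> r = 0")
  case True
  then show thesis
    using assms that(1)
    by (auto simp: edge_path_def Let_def path_image_join path_image_linepath in_segment algebra_simps)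
next
  case False
  then obtain t where t: "0 \<le> t" "t \<le> 1" "(x, y, z) = (1 - t) *\<^sub>R left_point c l + t *\<^sub>R right_point c r"
    using assms(1) by (auto simp: edge_path_def Let_def path_image_linepath in_segment)
  from lt3_cases[OF assms(2)] show thesis
  proof (elim disjE)
    assume l: "l = 0"
    then consider "r = 1" | "r = 2" using lt3_cases[OF assms(3)] False by auto
    then show thesis
    proof cases
      case 1
      then show thesis
        using t l by (intro that(2)) (auto simp: left_point_def right_point_def algebra_simps)
    next
      case 2
      then show thesis
        using t l by (intro that(3)) (auto simp: left_point_def right_point_def algebra_simps)
    qed
  next
    assume "l = 1"
    then show thesis
      using t by (intro that(4)[of t]) (auto simp: left_point_def right_point_def field_simps)
  next
    assume "l = 2"
    then show thesis
      using t by (intro that(5)[of t]) (auto simp: left_point_def right_point_def field_simps)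
  qed
qed

lemma pathstart_edge_path: "pathstart (edge_path c l r) = left_point c l"
  by (auto simp: edge_path_def Let_def left_point_def)

lemma pathfinish_edge_path: "pathfinish (edge_path c l r) = right_point c r"
  by (auto simp: edge_path_def Let_def right_point_def)

lemma left_ne_right: "left_point c l \<noteq> right_point c r"
  by (auto simp: left_point_def right_point_def)

lemma arc_edge_path: "arc (edge_path c l r)"
proof (cases "l = 0 \<and> r = 0")
  case True
  then show ?thesis
    by (auto simp: edge_path_def Let_def intro!: arc_join
        simp: path_image_join path_image_linepath in_segment)
next
  case False
  then show ?thesis
    by (auto simp: edge_path_def Let_def left_ne_right intro: arc_linepath)
qed

text \<open>Since 14/5 is less than 2 + 9/10, different copies lie in disjoint slabs and their arcs
  cannot meet.\<close>

lemma edge_path_x: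
  assumes "(x, y, z) \<in> path_image (edge_path c l r)" "l < 3" "r < 3"
  shows "2 * real c + 9/10 \<le> x \<and> x \<le> 2 * real c + 14/5"
  using assms by (cases rule: path_image_edge_path_cases) (auto simp: field_simps)

lemma edge_path_height_inj:
  assumes "r < 3" "s < 3"
    "(if r = 0 then 0 else if r = 1 then 1/2 else 3 :: real) = (if s = 0 then 0 else if s = 1 then 1/2 else 3)"
  shows "r = (s::nat)"
  using assms by (auto split: if_splits)

lemma edge_path_vertices:
  assumes "l < 3" "r < 3" "vertex_point v \<in> path_image (edge_path c l r)"
  shows "v = 6 * c + l \<or> v = 6 * c + 3 + r"
proof -
  obtain x y z where p: "vertex_point v = (x, y, z)" by (metis prod.exhaust)
  note q = assms(3)[unfolded p]
  have "real (v div 6) < real c + 1" "real c < real (v div 6) + 1"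
    using vertex_point_x[OF p] edge_path_x[OF q assms(1,2)] by linarith+
  then have d: "v div 6 = c" by linarith
  have m: "v mod 6 \<in> {0,1,2,3,4,5}" by auto
  from q assms(1,2) have "v mod 6 = l \<or> v mod 6 = 3 + r"
    by (cases rule: path_image_edge_path_cases)
      (use m p d lt3_cases[OF assms(2)] in
        \<open>auto simp: vertex_point_def left_point_def right_point_def field_simps split: if_splits\<close>)
  then show ?thesis using d by (metis add.assoc mult_div_mod_eq)
qed

text \<open>Within a copy, the arcs from left vertices 0, 1 and 2 lie on the central line, weakly
  left of it and weakly right of it; those of 1 and 2 reach the line only at a right vertex. It
  suffices to show that a common point is a vertex, as \<open>edge_path_vertices\<close> then makes
  it a common end.\<close>

lemma edge_path_cross:
  assumes "l < 3" "r < 3" "l' < 3" "r' < 3" "(c, l, r) \<noteq> (c', l', r')"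
    and p: "p \<in> path_image (edge_path c l r)" "p \<in> path_image (edge_path c' l' r')"
  shows "p \<in> {left_point c l, right_point c r, right_point c' r'}"
proof -
  obtain x y z where xyz: "p = (x, y, z)" by (metis prod.exhaust)
  note q = p[unfolded xyz]
  have "real c < real c' + 1" "real c' < real c + 1"
    using edge_path_x[OF q(1) assms(1,2)] edge_path_x[OF q(2) assms(3,4)] by linarith+
  then have c: "c = c'" by linarith
  have mid: "p \<in> {right_point c r, right_point c' r'}"
    if "x = 2 * real c + 1" "l \<noteq> 0 \<or> l' \<noteq> 0"
    using that(2)
  proof
    assume "l \<noteq> 0"
    from q(1) assms(1,2) show ?thesis
      by (cases rule: path_image_edge_path_cases)
        (use that \<open>l \<noteq> 0\<close> in \<open>auto simp: right_point_def xyz\<close>)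
  next
    assume "l' \<noteq> 0"
    from q(2) assms(3,4) show ?thesis
      by (cases rule: path_image_edge_path_cases)
        (use that \<open>l' \<noteq> 0\<close> c in \<open>auto simp: right_point_def xyz\<close>)
  qed
  have side: "(a = 0 \<longrightarrow> x = 2 * real c + 1) \<and> (a = 1 \<longrightarrow> x \<le> 2 * real c + 1) \<and> (a = 2 \<longrightarrow> x \<ge> 2 * real c + 1)"
    if "(x, y, z) \<in> path_image (edge_path c a b)" "a < 3" "b < 3" for a b
    using that by (cases rule: path_image_edge_path_cases) auto
  show ?thesis
  proof (cases "l = l'")
    case False
    then have "x = 2 * real c + 1"
      using side[OF q(1) assms(1,2)] side[OF q(2)[folded c] assms(3,4)]
        lt3_cases[OF assms(1)] lt3_cases[OF assms(3)] by auto
    then show ?thesis using mid False by auto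
  next
    case l: True
    then have r: "r \<noteq> r'" using assms(5) c by auto
    note q2 = q(2)[folded c l]
    from q(1) assms(1,2) show ?thesis
    proof (cases rule: path_image_edge_path_cases)
      case 1
      from q2 assms(1,4) show ?thesis
        by (cases rule: path_image_edge_path_cases)
          (use 1 r in \<open>auto simp: left_point_def right_point_def xyz\<close>)
    next
      case 2
      from q2 assms(1,4) show ?thesis
        by (cases rule: path_image_edge_path_cases)
          (use 2 r in \<open>auto simp: left_point_def right_point_def xyz\<close>)
    next
      case 3
      from q2 assms(1,4) show ?thesis
        by (cases rule: path_image_edge_path_cases)
          (use 3 r in \<open>auto simp: left_point_def right_point_def xyz\<close>)
    next
      case (4 t)
      from q2 assms(1,4) show ?thesis
      proof (cases rule: path_image_edge_path_cases)
        fix s assume s: "x = 2 * real c + 1 - (1 - s) / 10"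
          "y = 1 - s + s * (if r' = 0 then 0 else if r' = 1 then 1/2 else 3)"
        \<comment> \<open>The x-coordinate fixes the parameter, and different heights of the right
          ends then force it to be 0, which is the left vertex.\<close>
        have "s = t" using s 4 by simp
        then have "t = 0"
          using s 4 edge_path_height_inj[OF assms(2,4)] r by auto
        then show ?thesis using 4 by (simp add: left_point_def xyz)
      qed (use 4 in auto)
    next
      case (5 t)
      from q2 assms(1,4) show ?thesis
      proof (cases rule: path_image_edge_path_cases)
        fix s assume s: "x = 2 * real c + 1 + (1 - s) * (9/5)"
          "y = (1 - s) * (13/10) + s * (if r' = 0 then 0 else if r' = 1 then 1/2 else 3)"
        have "s = t" using s 5 by simp
        then have "t = 0"
          using s 5 edge_path_height_inj[OF assms(2,4)] r by auto
        then show ?thesis using 5 by (simp add: left_point_def xyz)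
      qed (use 5 in auto)
    qed
  qed
qed

text \<open>Every ball around \<open>p\<close> contains a point slightly displaced along
  \<open>d\<close>, so \<open>p\<close> is not interior.\<close>

lemma frontierI_direction:
  fixes p d :: "'a::real_normed_vector"
  assumes "p \<in> S" and "\<And>e. 0 < e \<Longrightarrow> e < 1 \<Longrightarrow> p + e *\<^sub>R d \<notin> S"
  shows "p \<in> frontier S"
proof -
  have "p \<notin> interior S"
  proof
    assume "p \<in> interior S"
    then obtain \<epsilon> where e: "\<epsilon> > 0" "ball p \<epsilon> \<subseteq> S" by (meson mem_interior)
    \<comment> \<open>Adding 1 to the norm keeps the denominator positive for \<open>d = 0\<close>
      as well.\<close>
    define t where "t = min (1/2) (\<epsilon> / (norm d + 1) / 2)"
    have pos: "0 < norm d + 1" by (rule add_nonneg_pos) auto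
    then have t: "0 < t" "t < 1" using e(1) by (auto simp: t_def)
    have "t * norm d \<le> \<epsilon> / (norm d + 1) / 2 * norm d"
      by (intro mult_right_mono) (auto simp: t_def)
    also have "\<dots> < \<epsilon>"
    proof -
      have "\<epsilon> * norm d < \<epsilon> * ((norm d + 1) * 2)"
        using e(1) by (intro mult_strict_left_mono) (smt (verit) norm_ge_zero)
      then show ?thesis using pos by (simp add: field_simps)
    qed
    finally have "p + t *\<^sub>R d \<in> ball p \<epsilon>"
      using t by (simp add: dist_norm)
    then show False using e(2) assms(2)[OF t] by blast
  qed
  then show ?thesis using assms(1) closure_subset by (auto simp: frontier_def)
qed

lemma edge_path_in_surface:
  assumes p: "(x, y, z) \<in> path_image (edge_path c l r)" and "l < 3" "r < 3" "c < g"
  shows "(x, y, z) \<in> genus_surface g"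
proof -
  have c: "real c + 1 \<le> real g" using assms(4) by simp
  have xr: "2 * real c + 9/10 \<le> x" "x \<le> 2 * real c + 14/5"
    using edge_path_x[OF assms(1,2,3)] by auto
  have inH: "(x, y, z) \<in> handlebody g"
    if "0 \<le> y" "y \<le> 3" "0 \<le> z" "z \<le> 1"
      "\<not> (2 * real c + 1 < x \<and> x < 2 * real c + 2 \<and> 1 < y \<and> y < 2)"
  proof -
    \<comment> \<open>The slab of copy \<open>c\<close> meets no tunnel other than its own.\<close>
    have "i = c" if "2 * real i + 1 < x" "x < 2 * real i + 2" for i
    proof -
      have "real i < real c + 1" "real c < real i + 1" using that xr by linarith+
      then show ?thesis by linarith
    qed
    then have "\<not> (\<exists>i<g. 2 * real i + 1 < x \<and> x < 2 * real i + 2 \<and> 1 < y \<and> y < 2)"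
      using that(5) by blast
    then show ?thesis using that xr c by (auto simp: handlebody_def)
  qed
  have top: "(x, y, z) \<in> genus_surface g" if "(x, y, z) \<in> handlebody g" "z = 1"
    unfolding genus_surface_def
    by (rule frontierI_direction[OF that(1), of "(0, 0, 1)"]) (simp add: handlebody_def that)
  from p assms(2,3) show ?thesis
  proof (cases rule: path_image_edge_path_cases)
    case 1
    then have H: "(x, y, z) \<in> handlebody g" by (intro inH) auto
    from 1(8) show ?thesis unfolding genus_surface_def
    proof (elim disjE)
      \<comment> \<open>On this piece the arc runs along a vertical edge of the tunnel, from which
        only a diagonal direction such as this one enters the open tunnel.\<close>
      assume "y = 1"
      then show "(x, y, z) \<in> frontier (handlebody g)"
        using 1(3) assms(4)
        by (intro frontierI_direction[OF H, of "(1, 1, 0)"])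
          (auto simp: handlebody_def intro!: exI[of _ c])
    next
      assume "z = 0"
      then show "(x, y, z) \<in> frontier (handlebody g)"
        by (intro frontierI_direction[OF H, of "(0, 0, -1)"]) (simp add: handlebody_def)
    next
      assume "y = 0"
      then show "(x, y, z) \<in> frontier (handlebody g)"
        by (intro frontierI_direction[OF H, of "(0, -1, 0)"]) (simp add: handlebody_def)
    qed
  next
    case 2
    then show ?thesis by (intro top inH) auto
  next
    case 3
    then show ?thesis by (intro top inH) auto
  next
    case (4 t)
    then show ?thesis using lt3_cases[OF assms(3)] by (intro top inH) auto
  next
    \<comment> \<open>At \<open>x = 2 * real c + 2\<close> the segment to right vertex 2 has
      y-coordinate 37/18, above 2, and the one to right vertex 1 has 17/18, below 1. Both move
      further away from the tunnel as \<open>x\<close> decreases, and the segment to right vertex 0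
      runs lower still.\<close>
    case (5 t)
    then show ?thesis using lt3_cases[OF assms(3)]
      by (intro top inH) (auto simp: field_simps)
  qed
qed

lemma k33s_subset: "e \<in> k33s g \<Longrightarrow> e \<subseteq> {..<6 * g}"
  by (auto simp: k33s_def)

lemma embeds_in_genus_surface_k33s: "embeds_in {..<6 * g} (k33s g) (genus_surface g)"
proof -
  \<comment> \<open>The left vertex of an edge is the smaller one, so \<open>Min\<close> and
    \<open>Max\<close> recover the copy and both indices from the unordered pair.\<close>
  define \<gamma> where "\<gamma> e = edge_path (Min e div 6) (Min e mod 6) (Max e mod 6 - 3)" for e :: "nat set"
  have \<gamma>: "\<gamma> {6 * c + l, 6 * c + 3 + r} = edge_path c l r" if "l < 3" "r < 3" for c l r
  proof -
    have "Min {6 * c + l, 6 * c + 3 + r} = 6 * c + l" "Max {6 * c + l, 6 * c + 3 + r} = 6 * c + 3 + r"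
      using that by auto
    then show ?thesis using that by (simp add: \<gamma>_def vertex_div_mod[OF that])
  qed
  have surf: "path_image (\<gamma> e) \<subseteq> genus_surface g" if "e \<in> k33s g" for e
    using that edge_path_in_surface by (auto simp: k33s_def \<gamma>)
  have ends: "{pathstart (\<gamma> e), pathfinish (\<gamma> e)} = vertex_point ` e" if "e \<in> k33s g" for e
    using that by (auto simp: k33s_def \<gamma> pathstart_edge_path pathfinish_edge_path vertex_point_simps)
  have vert: "v \<in> e" if "e \<in> k33s g" "vertex_point v \<in> path_image (\<gamma> e)" for e v
    using that edge_path_vertices by (fastforce simp: k33s_def \<gamma>)
  have ends': "vertex_point ` e \<subseteq> path_image (\<gamma> e)" if "e \<in> k33s g" for e
    unfolding ends[OF that, symmetric]
    by (simp add: pathstart_in_path_image pathfinish_in_path_image)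
  have cross: "path_image (\<gamma> e) \<inter> path_image (\<gamma> f) \<subseteq> vertex_point ` (e \<inter> f)"
    if "e \<in> k33s g" "f \<in> k33s g" "e \<noteq> f" for e f
  proof
    fix p assume p: "p \<in> path_image (\<gamma> e) \<inter> path_image (\<gamma> f)"
    obtain c l r where e: "e = {6 * c + l, 6 * c + 3 + r}" "l < 3" "r < 3"
      using \<open>e \<in> k33s g\<close> by (auto simp: k33s_def)
    obtain c' l' r' where f: "f = {6 * c' + l', 6 * c' + 3 + r'}" "l' < 3" "r' < 3"
      using \<open>f \<in> k33s g\<close> by (auto simp: k33s_def)
    have "(c, l, r) \<noteq> (c', l', r')" using e f \<open>e \<noteq> f\<close> by auto
    then have "p \<in> {left_point c l, right_point c r, right_point c' r'}"
      using p e f by (intro edge_path_cross) (auto simp: \<gamma>)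
    \<comment> \<open>A common point that is a vertex lies in both edges by \<open>vert\<close>,
      hence in their intersection.\<close>
    then obtain v where v: "p = vertex_point v"
      using vertex_point_simps e f by (metis empty_iff insert_iff)
    then show "p \<in> vertex_point ` (e \<inter> f)"
      using p vert that by auto
  qed
  have arc: "arc (\<gamma> e)" if "e \<in> k33s g" for e
    using that by (auto simp: k33s_def \<gamma> arc_edge_path)
  have img: "vertex_point ` {..<6 * g} \<subseteq> genus_surface g"
  proof (rule image_subsetI)
    fix v assume "v \<in> {..<6 * g}"
    then have "v < 6 * g" by simp
    then have "\<exists>e\<in>k33s g. v \<in> e"
    proof (cases rule: lessThan_k33sE)
      case (1 c l)
      then have "{6 * c + l, 6 * c + 3 + 0} \<in> k33s g" unfolding k33s_def by fastforce
      then show ?thesis using 1 by blast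
    next
      case (2 c r)
      then have "{6 * c + 0, 6 * c + 3 + r} \<in> k33s g" unfolding k33s_def by fastforce
      then show ?thesis using 2 by blast
    qed
    then show "vertex_point v \<in> genus_surface g"
      using ends' surf by blast
  qed
  have inj: "inj_on vertex_point {..<6 * g}"
    using vertex_point_inj by (rule inj_on_subset) simp
  have meet: "path_image (\<gamma> e) \<inter> vertex_point ` {..<6 * g} = vertex_point ` e" if "e \<in> k33s g" for e
    using vert[OF that] ends'[OF that] k33s_subset[OF that] by auto
  show ?thesis
    unfolding embeds_in_def
    by (intro exI[of _ vertex_point] exI[of _ \<gamma>] conjI ballI impI)
      (assumption | rule surf ends cross arc img inj meet)+
qed

section \<open>The lower bound\<close>

theorem theorem1p1:
  fixes g :: nat
  assumes "g \<ge> 1"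
  shows "ereal_of_enat (pf_max g) \<ge> ereal ((8 / 3) ^ g) \<and>
    (\<exists>(V :: nat set) E. simple_graph V E \<and> even (card V) \<and>
       orientable_genus V E \<le> g \<and> real (pf V E) \<ge> (8 / 3) ^ g)"
proof -
  let ?V = "{..<6 * g}" and ?E = "k33s g"
  have simple: "simple_graph ?V ?E"
    by (auto simp: simple_graph_def k33s_def)
  have even: "even (card ?V)" by simp
  have genus: "orientable_genus ?V ?E \<le> g"
    unfolding orientable_genus_def by (rule Least_le) (rule embeds_in_genus_surface_k33s)
  have "k_pfaffian ?V ?E (pf ?V ?E)"
    \<comment> \<open>Existence of an admissible \<open>k\<close> makes the least one admissible, so
      the counting bound applies to \<open>pf\<close> itself.\<close>
    unfolding pf_def using LeastI_ex[OF k_pfaffian_k33s_exists[of g]] by blast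
  then have "16 ^ g \<le> pf ?V ?E * 6 ^ g" by (rule k_pfaffian_k33s_bound)
  then have "real (16 ^ g) \<le> real (pf ?V ?E * 6 ^ g)" by (rule of_nat_mono)
  moreover have "(8 / 3) ^ g * 6 ^ g = (16 :: real) ^ g" by (simp flip: power_mult_distrib)
  ultimately have "(8 / 3) ^ g * 6 ^ g \<le> real (pf ?V ?E) * 6 ^ g" by simp
  then have pf: "(8 / 3) ^ g \<le> real (pf ?V ?E)" by (rule mult_right_le_imp_le) simp
  have "enat (pf ?V ?E) \<le> pf_max g"
    unfolding pf_max_def using simple even genus
    by (intro SUP_upper2[of "(?V, ?E)"]) simp_all
  then have "ereal_of_enat (enat (pf ?V ?E)) \<le> ereal_of_enat (pf_max g)"
    by (rule ereal_of_enat_le_iff[THEN iffD2])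
  then have "ereal ((8 / 3) ^ g) \<le> ereal_of_enat (pf_max g)"
    using pf by (metis ereal_less_eq(3) ereal_of_enat_simps(1) order_trans)
  then show ?thesis using simple even genus pf by blast
qed

end
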